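(* Let $\mathcal{M}=\mathcal{M}(\Sigma,I)$ be an irreducible trace monoid, and let $p_0$ be the unique root of smallest modulus of the single-variable Möbius polynomial $\mu_{\mathcal{M}}(X)=\sum_{c\in\mathscr{C}}(-1)^{|c|}X^{|c|}$. Then: 1. There exists a unique uniform Bernoulli measure $\mathbb{P}_0$ on $(\partial\mathcal{M},\mathfrak{F})$. It is entirely characterized by $\mathbb{P}_0(\uparrow u)=p_0^{|u|}$ for all $u\in\mathcal{M}$. 2. Any uniform measure on $(\partial\mathcal{M},\mathfrak{F})$ is uniform Bernoulli. Hence $\mathbb{P}_0$ is also the unique uniform measure on $(\partial\mathcal{M},\mathfrak{F})$.
   Context: Trace monoids. An independence pair $(\Sigma,I)$ consists of a finite non-empty set $\Sigma$ (letters) and an irreflexive symmetric relation $I\subseteq\Sigma\times\Sigma$. The trace monoid is $\mathcal{M}=\mathcal{M}(\Sigma,I)=\langle\Sigma\mid\alpha\cdot\beta=\beta\cdot\alpha\text{ for }(\alpha,\beta)\in I\rangle$; its elements are called traces, its unit is denoted $0$, and $|u|$ is the length of any word representing $u$. It is irreducible if the undirected graph $(\Sigma,D)$, with $D=(\Sigma\times\Sigma)\setminus I$, is connected. Left divisibility: $u\leq v$ iff $v=u\cdot w$ for some $w\in\mathcal{M}$; this is a partial order. Cliques. A clique is a trace $\alpha_1\cdot\ldots\cdot\alpha_n$, $n\geq0$, with $(\alpha_i,\alpha_j)\in I$ for all $i\neq j$. $\mathscr{C}$ is the (finite) set of cliques, including the empty clique $0$. Known fact. The polynomial $\mu_{\mathcal{M}}(X)$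 has a unique (complex) root of smallest modulus, and this root is real and positive. Boundary. Consider non-decreasing sequences $(u_k)_{k\geq0}$ in $(\mathcal{M},\leq)$, pre-ordered by $(u_k)\preccurlyeq(u'_k)$ iff for every $k$ there is $k'$ with $u_k\leq u'_{k'}$. Let $(\mathcal{W},\leq)$ be the partial order obtained by quotienting by the associated equivalence. $\mathcal{M}$ embeds in $\mathcal{W}$ through constant sequences. The boundary is $\partial\mathcal{M}=\mathcal{W}\setminus\mathcal{M}$. For $u\in\mathcal{M}$, $\uparrow u=\{\xi\in\partial\mathcal{M}: u\leq\xi\}$, and $\mathfrak{F}$ is the $\sigma$-algebra on $\partial\mathcal{M}$ generated by all sets $\uparrow u$, $u\in\mathcal{M}$. Measures. A probability measure $\mathbb{P}$ on $(\partial\mathcal{M},\mathfrak{F})$ is Bernoulli if $\mathbb{P}(\uparrow u)>0$ for all $u\in\mathcal{M}$ and $\mathbb{P}(\uparrow(u\cdot v))=\mathbb{P}(\uparrow u)\,\mathbb{P}(\uparrow v)$ for all $u,v\in\mathcal{M}$. It is uniform Bernoulli if it is Bernoulli and the numbers $\mathbb{P}(\uparrow\alpha)$, $\alpha\in\Sigma$, are all equal. A probability measure $\mathbb{P}$ on $(\partial\mathcal{M},\mathfrak{F})$ is uniform if for all $u,v\in\mathcal{M}$, $|u|=|v|$ implies $\mathbb{P}(\uparrow u)=\mathbb{P}(\uparrow v)$. *)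

theory Defs
  imports "HOL-Probability.Probability" "HOL-Computational_Algebra.Polynomial"
    "HOL-Algebra.Divisibility"
begin

definition independence_pair :: "'a set \<Rightarrow> ('a \<times> 'a) set \<Rightarrow> bool" where
  "independence_pair S I \<longleftrightarrow>
     finite S \<and> S \<noteq> {} \<and> I \<subseteq> S \<times> S \<and> irrefl I \<and> sym I"

inductive trace_eq :: "('a \<times> 'a) set \<Rightarrow> 'a list \<Rightarrow> 'a list \<Rightarrow> bool" for I where
  comm: "(a, b) \<in> I \<Longrightarrow> trace_eq I [a, b] [b, a]"
| refl: "trace_eq I u u"
| sym: "trace_eq I u v \<Longrightarrow> trace_eq I v u"
| trans: "trace_eq I u v \<Longrightarrow> trace_eq I v w \<Longrightarrow> trace_eq I u w"
| cong: "trace_eq I u u' \<Longrightarrow> trace_eq I v v' \<Longrightarrow> trace_eq I (u @ v) (u' @ v')"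

definition trace_rel :: "'a set \<Rightarrow> ('a \<times> 'a) set \<Rightarrow> ('a list \<times> 'a list) set" where
  "trace_rel S I = {(u, v). u \<in> lists S \<and> v \<in> lists S \<and> trace_eq I u v}"

definition trace_of :: "'a set \<Rightarrow> ('a \<times> 'a) set \<Rightarrow> 'a list \<Rightarrow> 'a list set" where
  "trace_of S I w = trace_rel S I `` {w}"

definition trace_monoid :: "'a set \<Rightarrow> ('a \<times> 'a) set \<Rightarrow> 'a list set monoid" where
  "trace_monoid S I =
     \<lparr>carrier = lists S // trace_rel S I,
      monoid.mult = (\<lambda>u v. \<Union>x\<in>u. \<Union>y\<in>v. trace_of S I (x @ y)),
      one = trace_of S I []\<rparr>"

definition trace_length :: "'a list set \<Rightarrow> nat" where
  "trace_length u = length (SOME w. w \<in> u)"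

definition irreducible_pair :: "'a set \<Rightarrow> ('a \<times> 'a) set \<Rightarrow> bool" where
  "irreducible_pair S I \<longleftrightarrow> (\<forall>a\<in>S. \<forall>b\<in>S. (a, b) \<in> (S \<times> S - I)\<^sup>*)"

definition cliques :: "'a set \<Rightarrow> ('a \<times> 'a) set \<Rightarrow> 'a list set set" where
  "cliques S I = {trace_of S I w | w. w \<in> lists S \<and>
     (\<forall>i<length w. \<forall>j<length w. i \<noteq> j \<longrightarrow> (w ! i, w ! j) \<in> I)}"

definition moebius_poly :: "'a set \<Rightarrow> ('a \<times> 'a) set \<Rightarrow> complex poly" where
  "moebius_poly S I =
     (\<Sum>c\<in>cliques S I. monom ((-1) ^ trace_length c) (trace_length c))"

definition unique_smallest_root :: "complex poly \<Rightarrow> complex \<Rightarrow> bool" where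
  "unique_smallest_root p z \<longleftrightarrow>
     poly p z = 0 \<and> (\<forall>w. poly p w = 0 \<and> w \<noteq> z \<longrightarrow> cmod z < cmod w)"

text \<open>The relation \<open>u divides\<^bsub>M\<^esub> v\<close> of HOL-Algebra is left divisibility:
  \<open>v = u \<otimes>\<^bsub>M\<^esub> w\<close> for some \<open>w\<close> in the carrier.\<close>

definition trace_seqs :: "'a set \<Rightarrow> ('a \<times> 'a) set \<Rightarrow> (nat \<Rightarrow> 'a list set) set" where
  "trace_seqs S I = {s. (\<forall>k. s k \<in> carrier (trace_monoid S I)) \<and>
     (\<forall>j k. j \<le> k \<longrightarrow> s j divides\<^bsub>trace_monoid S I\<^esub> s k)}"

definition seq_le ::
  "'a set \<Rightarrow> ('a \<times> 'a) set \<Rightarrow> (nat \<Rightarrow> 'a list set) \<Rightarrow> (nat \<Rightarrow> 'a list set) \<Rightarrow> bool" where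
  "seq_le S I s t \<longleftrightarrow> (\<forall>k. \<exists>k'. s k divides\<^bsub>trace_monoid S I\<^esub> t k')"

definition seq_rel ::
  "'a set \<Rightarrow> ('a \<times> 'a) set \<Rightarrow> ((nat \<Rightarrow> 'a list set) \<times> (nat \<Rightarrow> 'a list set)) set" where
  "seq_rel S I = {(s, t). s \<in> trace_seqs S I \<and> t \<in> trace_seqs S I \<and>
     seq_le S I s t \<and> seq_le S I t s}"

definition gen_traces :: "'a set \<Rightarrow> ('a \<times> 'a) set \<Rightarrow> (nat \<Rightarrow> 'a list set) set set" where
  "gen_traces S I = trace_seqs S I // seq_rel S I"

definition gen_le ::
  "'a set \<Rightarrow> ('a \<times> 'a) set \<Rightarrow> (nat \<Rightarrow> 'a list set) set \<Rightarrow> (nat \<Rightarrow> 'a list set) set \<Rightarrow> bool"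
  where "gen_le S I \<xi> \<eta> \<longleftrightarrow> (\<exists>s\<in>\<xi>. \<exists>t\<in>\<eta>. seq_le S I s t)"

definition embed :: "'a set \<Rightarrow> ('a \<times> 'a) set \<Rightarrow> 'a list set \<Rightarrow> (nat \<Rightarrow> 'a list set) set" where
  "embed S I u = seq_rel S I `` {\<lambda>_. u}"

definition boundary :: "'a set \<Rightarrow> ('a \<times> 'a) set \<Rightarrow> (nat \<Rightarrow> 'a list set) set set" where
  "boundary S I = gen_traces S I - embed S I ` carrier (trace_monoid S I)"

definition up :: "'a set \<Rightarrow> ('a \<times> 'a) set \<Rightarrow> 'a list set \<Rightarrow> (nat \<Rightarrow> 'a list set) set set" where
  "up S I u = {\<xi> \<in> boundary S I. gen_le S I (embed S I u) \<xi>}"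

definition boundary_space ::
  "'a set \<Rightarrow> ('a \<times> 'a) set \<Rightarrow> (nat \<Rightarrow> 'a list set) set measure" where
  "boundary_space S I = sigma (boundary S I) (up S I ` carrier (trace_monoid S I))"

definition boundary_prob ::
  "'a set \<Rightarrow> ('a \<times> 'a) set \<Rightarrow> (nat \<Rightarrow> 'a list set) set measure \<Rightarrow> bool" where
  "boundary_prob S I P \<longleftrightarrow> prob_space P \<and> sets P = sets (boundary_space S I)"

definition bernoulli_measure ::
  "'a set \<Rightarrow> ('a \<times> 'a) set \<Rightarrow> (nat \<Rightarrow> 'a list set) set measure \<Rightarrow> bool" where
  "bernoulli_measure S I P \<longleftrightarrow> boundary_prob S I P \<and>
     (\<forall>u\<in>carrier (trace_monoid S I). measure P (up S I u) > 0) \<and>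
     (\<forall>u\<in>carrier (trace_monoid S I). \<forall>v\<in>carrier (trace_monoid S I).
        measure P (up S I (u \<otimes>\<^bsub>trace_monoid S I\<^esub> v)) =
        measure P (up S I u) * measure P (up S I v))"

definition uniform_bernoulli_measure ::
  "'a set \<Rightarrow> ('a \<times> 'a) set \<Rightarrow> (nat \<Rightarrow> 'a list set) set measure \<Rightarrow> bool" where
  "uniform_bernoulli_measure S I P \<longleftrightarrow> bernoulli_measure S I P \<and>
     (\<forall>a\<in>S. \<forall>b\<in>S.
        measure P (up S I (trace_of S I [a])) = measure P (up S I (trace_of S I [b])))"

definition uniform_boundary_measure ::
  "'a set \<Rightarrow> ('a \<times> 'a) set \<Rightarrow> (nat \<Rightarrow> 'a list set) set measure \<Rightarrow> bool" where
  "uniform_boundary_measure S I P \<longleftrightarrow> boundary_prob S I P \<and>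
     (\<forall>u\<in>carrier (trace_monoid S I). \<forall>v\<in>carrier (trace_monoid S I).
        trace_length u = trace_length v \<longrightarrow>
        measure P (up S I u) = measure P (up S I v))"

lemma trace_eq_length: "trace_eq I u v \<Longrightarrow> length u = length v"
  by (induction rule: trace_eq.induct) auto

lemma equiv_trace_rel: "equiv (lists S) (trace_rel S I)"
proof (rule equivI)
  show "trace_rel S I \<subseteq> lists S \<times> lists S"
    by (auto simp: trace_rel_def)
  show "refl_on (lists S) (trace_rel S I)"
    by (simp add: trace_rel_def refl_on_def trace_eq.refl)
  show "sym (trace_rel S I)"
    by (simp add: trace_rel_def sym_def trace_eq.sym)
  show "trans (trace_rel S I)"
    unfolding trace_rel_def trans_def using trace_eq.trans[of I] by blast
qed

lemma trace_length_trace_of: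
  assumes "w \<in> lists S"
  shows "trace_length (trace_of S I w) = length w"
proof -
  have "w \<in> trace_of S I w"
    using assms by (auto simp: trace_of_def trace_rel_def intro: trace_eq.refl)
  hence "(SOME x. x \<in> trace_of S I w) \<in> trace_of S I w"
    by (rule someI)
  moreover have "length v = length w" if "v \<in> trace_of S I w" for v
    using that trace_eq_length[of I w v] by (simp add: trace_of_def trace_rel_def)
  ultimately show ?thesis
    unfolding trace_length_def by blast
qed

lemma trace_mult_trace_of:
  assumes "x \<in> lists S" "y \<in> lists S"
  shows "trace_of S I x \<otimes>\<^bsub>trace_monoid S I\<^esub> trace_of S I y = trace_of S I (x @ y)"
proof -
  have *: "trace_of S I (x' @ y') = trace_of S I (x @ y)"
    if "x' \<in> trace_of S I x" "y' \<in> trace_of S I y" for x' y'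
    unfolding trace_of_def
  proof (rule equiv_class_eq[OF equiv_trace_rel])
    show "(x' @ y', x @ y) \<in> trace_rel S I"
      using that by (simp add: trace_of_def trace_rel_def trace_eq.cong trace_eq.sym)
  qed
  have "x \<in> trace_of S I x" "y \<in> trace_of S I y"
    using assms by (auto simp: trace_of_def trace_rel_def intro: trace_eq.refl)
  with * have "(\<Union>x'\<in>trace_of S I x. \<Union>y'\<in>trace_of S I y. trace_of S I (x' @ y')) =
      trace_of S I (x @ y)"
    by blast
  thus ?thesis
    by (simp add: trace_monoid_def)
qed

end

theory Submission
  imports Defs "HOL-Library.Sublist" "HOL-Library.Landau_Symbols"
    "HOL-Computational_Algebra.Fundamental_Theorem_Algebra"
begin

text \<open>
  Two words are trace equivalent iff their projections to all pairs of dependent letters agree, and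
  left divisibility is the prefix order on these projections. This makes traces cancellative, with
  least common multiples of pairs that have a common multiple.

  Let \<open>R\<close> be the radius of convergence of the growth series \<open>G(z) = (\<Sum>u. z\<^sup>|\<^sup>u\<^sup>|)\<close>. Moebius
  inversion gives \<open>\<mu>(z) G(z) = 1\<close> for \<open>|z| < R\<close>. The numbers \<open>a\<^sub>n\<close> of traces of length \<open>n\<close> are
  submultiplicative, so that \<open>a\<^sub>n R\<^sup>n \<ge> 1\<close>; hence \<open>G(s)\<close> tends to infinity as \<open>s\<close> increases to \<open>R\<close>,
  and \<open>p\<^sub>0 = R\<close>.

  Existence: the distributions on traces with weights \<open>s\<^sup>|\<^sup>u\<^sup>| / G(s)\<close> give the set of multiples of
  \<open>u\<close> the mass \<open>s\<^sup>|\<^sup>u\<^sup>|\<close>. Any cluster point for \<open>s \<rightarrow> R\<close> is a finitely additive probability that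
  vanishes on single traces. Identify a trace with the set of traces below it: on the compact space
  of all sets of traces the cluster point becomes countably additive, and almost every set consists
  of the traces below a boundary point.

  Uniqueness: let \<open>f n\<close> be the common mass of \<open>up u\<close> for \<open>|u| = n\<close>. By inclusion-exclusion, \<open>f\<close>
  satisfies a linear recurrence with characteristic polynomial \<open>\<mu>\<close>. Let \<open>w\<close> spell a walk through
  all letters in the dependence graph, which is connected. The sets \<open>up (u w)\<close>, \<open>|u| = n\<close>, are
  pairwise disjoint, so that \<open>a\<^sub>n f(n + |w|) \<le> 1\<close> and \<open>f n = O(R\<^sup>n)\<close>. As all other roots of \<open>\<mu>\<close> have
  larger modulus, this forces \<open>f n = R\<^sup>n\<close>.
\<close>

section \<open>Prefixes, walks and chains\<close>

lemma prefix_if_count_last_le: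
  assumes "prefix p t" "prefix q t" "p \<noteq> []" "count_list p (last p) \<le> count_list q (last p)"
  shows "prefix p q"
proof (rule ccontr)
  assume "\<not> prefix p q"
  then have "prefix q p" "q \<noteq> p" using assms(1,2) prefix_same_cases by blast+
  then obtain s where s: "p = q @ s" "s \<noteq> []" by (auto simp: prefix_def)
  then have "last p \<in> set s" by simp
  then have "count_list s (last p) > 0" by (simp add: count_list_0_iff zero_less_iff_neq_zero)
  then show False using assms(4) s by simp
qed

lemma rtrancl_extend_successively:
  assumes "(last w, a) \<in> R\<^sup>*" "w \<noteq> []" "successively (\<lambda>x y. (x, y) \<in> R) w"
  shows "\<exists>w'. successively (\<lambda>x y. (x, y) \<in> R) (w @ w') \<and> last (w @ w') = a \<and> set w' \<subseteq> Range R"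
  using assms
proof (induction rule: rtrancl_induct)
  case base
  then show ?case by (intro exI[of _ "[]"]) auto
next
  case (step y z)
  then obtain w' where "successively (\<lambda>x y. (x, y) \<in> R) (w @ w')" "last (w @ w') = y"
    "set w' \<subseteq> Range R" by blast
  then have "successively (\<lambda>x y. (x, y) \<in> R) (w @ w' @ [z])"
    using step.hyps step.prems successively_append_iff[of _ "w @ w'" "[z]"] by simp
  then show ?case using \<open>set w' \<subseteq> Range R\<close> step.hyps by (intro exI[of _ "w' @ [z]"]) auto
qed

lemma ex_covering_walk:
  assumes "finite F" "F \<subseteq> S" "S \<noteq> {}" "R \<subseteq> S \<times> S" and conn: "\<forall>a\<in>S. \<forall>b\<in>S. (a, b) \<in> R\<^sup>*"
  shows "\<exists>w. w \<noteq> [] \<and> F \<subseteq> set w \<and> set w \<subseteq> S \<and> successively (\<lambda>x y. (x, y) \<in> R) w"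
  using assms(1,2)
proof (induction rule: finite_induct)
  case empty
  obtain a where "a \<in> S" using \<open>S \<noteq> {}\<close> by blast
  then show ?case by (intro exI[of _ "[a]"]) auto
next
  case (insert x F)
  then obtain w where w: "w \<noteq> []" "F \<subseteq> set w" "set w \<subseteq> S" "successively (\<lambda>x y. (x, y) \<in> R) w"
    by auto
  have "(last w, x) \<in> R\<^sup>*" using conn w insert.prems last_in_set[of w] by blast
  then obtain w' where w': "successively (\<lambda>x y. (x, y) \<in> R) (w @ w')" "last (w @ w') = x"
    "set w' \<subseteq> Range R" using rtrancl_extend_successively[OF _ w(1,4)] by blast
  have "x \<in> set (w @ w')" using w' w(1) last_in_set[of "w @ w'"] by simp
  then show ?case using w w' assms(4) by (intro exI[of _ "w @ w'"]) auto
qed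

lemma countable_directed_cofinal_chain:
  assumes "countable J" "J \<noteq> {}" and refl: "\<And>x. x \<in> J \<Longrightarrow> R x x"
    and trans: "\<And>x y z. x \<in> J \<Longrightarrow> y \<in> J \<Longrightarrow> z \<in> J \<Longrightarrow> R x y \<Longrightarrow> R y z \<Longrightarrow> R x z"
    and directed: "\<And>x y. x \<in> J \<Longrightarrow> y \<in> J \<Longrightarrow> \<exists>z\<in>J. R x z \<and> R y z"
  shows "\<exists>s :: nat \<Rightarrow> 'b. (\<forall>k. s k \<in> J) \<and> (\<forall>j k. j \<le> k \<longrightarrow> R (s j) (s k)) \<and> (\<forall>x\<in>J. \<exists>k. R x (s k))"
proof -
  let ?e = "from_nat_into J"
  have e: "?e k \<in> J" for k using \<open>J \<noteq> {}\<close> by (rule from_nat_into)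
  have "\<exists>s. \<forall>k. (s k \<in> J \<and> R (?e k) (s k)) \<and> R (s k) (s (Suc k))"
  proof (rule dependent_nat_choice)
    show "\<exists>x. x \<in> J \<and> R (?e 0) x" using e refl by blast
    show "\<exists>y. (y \<in> J \<and> R (?e (Suc k)) y) \<and> R x y" if "x \<in> J \<and> R (?e k) x" for x k
      using directed[of x "?e (Suc k)"] e that by blast
  qed
  then obtain s where s: "\<And>k. s k \<in> J" "\<And>k. R (?e k) (s k)" "\<And>k. R (s k) (s (Suc k))"
    by blast
  have "R (s j) (s k)" if "j \<le> k" for j k
    using that by (rule transitive_stepwise_le) (use s refl trans in blast)+
  moreover have "\<exists>k. R x (s k)" if "x \<in> J" for x
    using from_nat_into_surj[OF \<open>countable J\<close> that] s(2) by metis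
  ultimately show ?thesis using s(1) by blast
qed

section \<open>Linear recurrences\<close>

definition shift_op :: "'c :: comm_ring_1 poly \<Rightarrow> (nat \<Rightarrow> 'c) \<Rightarrow> nat \<Rightarrow> 'c" where
  "shift_op q y n = (\<Sum>i\<le>degree q. coeff q i * y (n + i))"

lemma shift_op_altdef:
  "degree q \<le> N \<Longrightarrow> shift_op q y n = (\<Sum>i\<le>N. coeff q i * y (n + i))"
  unfolding shift_op_def by (intro sum.mono_neutral_left) (auto simp: coeff_eq_0)

lemma shift_op_0 [simp]: "shift_op 0 y n = 0"
  by (simp add: shift_op_def)

lemma shift_op_add: "shift_op (p + q) y n = shift_op p y n + shift_op q y n"
proof -
  let ?N = "max (degree p) (degree q)"
  have "degree (p + q) \<le> ?N" by (rule degree_add_le_max)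
  then show ?thesis by (simp add: shift_op_altdef[of _ ?N] sum.distrib algebra_simps)
qed

lemma shift_op_sum: "shift_op (\<Sum>c\<in>A. f c) y n = (\<Sum>c\<in>A. shift_op (f c) y n)"
  by (induction A rule: infinite_finite_induct) (simp_all add: shift_op_add)

lemma shift_op_smult: "shift_op (smult a q) y n = a * shift_op q y n"
  by (subst shift_op_altdef[OF degree_smult_le])
    (simp add: shift_op_def sum_distrib_left mult.assoc)

lemma shift_op_pCons: "shift_op (pCons a q) y n = a * y n + shift_op q y (Suc n)"
  by (subst shift_op_altdef[OF degree_pCons_le])
    (simp add: shift_op_def sum.atMost_Suc_shift del: sum.atMost_Suc)

lemma shift_op_monom: "shift_op (monom a k) y n = a * y (n + k)"
  by (induction k arbitrary: n) (simp_all add: monom_Suc shift_op_pCons monom_0)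

lemma shift_op_mult: "shift_op (p * q) y n = shift_op p (shift_op q y) n"
proof (induction p arbitrary: n)
  case (pCons a p)
  then show ?case by (simp add: shift_op_add shift_op_smult shift_op_pCons)
qed simp

lemma shift_op_in_bigo_geometric:
  fixes q :: "'c :: real_normed_field poly"
  assumes "y \<in> O(\<lambda>n. p ^ n)"
  shows "shift_op q y \<in> O(\<lambda>n. p ^ n)"
proof -
  have "(\<lambda>n. coeff q i * y (n + i)) \<in> O(\<lambda>n. p ^ n)" for i
  proof -
    have "(\<lambda>n. y (n + i)) \<in> O(\<lambda>n. p ^ (n + i))"
      using landau_o.big.compose[OF assms filterlim_add_const_nat_at_top] by simp
    then have "(\<lambda>n. y (n + i)) \<in> O(\<lambda>n. p ^ n)"
      by (rule landau_o.big.trans) (simp add: power_add)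
    then show ?thesis by simp
  qed
  then have "(\<lambda>n. \<Sum>i\<le>degree q. coeff q i * y (n + i)) \<in> O(\<lambda>n. p ^ n)"
    by (intro big_sum_in_bigo)
  then show ?thesis by (simp add: shift_op_def[abs_def])
qed

lemma geometric_eq_0_if_bigo_smaller:
  fixes x :: "nat \<Rightarrow> 'c :: real_normed_field"
  assumes x: "\<And>n. x (Suc n) = w * x n" and "norm p < norm w" and bigo: "x \<in> O(\<lambda>n. p ^ n)"
  shows "x n = 0"
proof -
  have "w \<noteq> 0" using assms(2) by auto
  have pow: "x n = w ^ n * x 0" for n by (induction n) (simp_all add: x)
  have "x 0 = 0"
  proof (rule ccontr)
    assume "x 0 \<noteq> 0"
    have "(\<lambda>n. (p / w) ^ n) \<longlonglongrightarrow> 0"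
      using assms(2) \<open>w \<noteq> 0\<close> by (intro LIMSEQ_power_zero) (simp add: norm_divide)
    then have "(\<lambda>n. p ^ n) \<in> o(\<lambda>n. w ^ n)"
      using \<open>w \<noteq> 0\<close> by (intro smalloI_tendsto) (simp_all add: power_divide)
    also have "(\<lambda>n. w ^ n) \<in> O(\<lambda>n. w ^ n * x 0)" using \<open>x 0 \<noteq> 0\<close> by simp
    also have "(\<lambda>n. w ^ n * x 0) = x" by (rule ext) (rule pow[symmetric])
    finally have "eventually (\<lambda>n. x n = 0) sequentially"
      using bigo landau_o.big_small_asymmetric by blast
    then obtain n where "x n = 0" by (auto simp: eventually_sequentially)
    then show False using \<open>x 0 \<noteq> 0\<close> \<open>w \<noteq> 0\<close> pow[of n] by simp
  qed
  then show ?thesis using pow[of n] by simp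
qed

lemma geometric_if_double_root_bigo:
  fixes x d :: "nat \<Rightarrow> 'c :: real_normed_field"
  assumes "p \<noteq> 0" and bigo: "x \<in> O(\<lambda>n. p ^ n)"
    and x: "\<And>n. x (Suc n) = p * x n + d n" and d: "\<And>n. d (Suc n) = p * d n"
  shows "x (Suc n) = p * x n"
proof -
  have d_pow: "d n = p ^ n * d 0" for n by (induction n) (simp_all add: d)
  have x_pow: "x n = p ^ n * (x 0 + of_nat n * (d 0 / p))" for n
  proof (induction n)
    case (Suc n)
    then show ?case using \<open>p \<noteq> 0\<close> by (simp add: x d_pow[of n] field_simps)
  qed simp
  have "d 0 = 0"
  proof (rule ccontr)
    assume "d 0 \<noteq> 0"
    then have "filterlim (\<lambda>n. d 0 / p * of_nat n) at_infinity sequentially"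
      using \<open>p \<noteq> 0\<close>
      by (intro tendsto_mult_filterlim_at_infinity[OF tendsto_const _ tendsto_of_nat]) simp
    then have "filterlim (\<lambda>n. of_nat n * (d 0 / p)) at_infinity sequentially"
      by (simp add: mult.commute)
    then have "filterlim (\<lambda>n. x 0 + of_nat n * (d 0 / p)) at_infinity sequentially"
      by (rule tendsto_add_filterlim_at_infinity[OF tendsto_const])
    then have lim: "filterlim (\<lambda>n. norm (x 0 + of_nat n * (d 0 / p))) at_top sequentially"
      by (rule filterlim_at_infinity_imp_norm_at_top)
    obtain C where "eventually (\<lambda>n. norm (x n) \<le> C * norm (p ^ n)) sequentially"
      using bigo by (rule landau_o.bigE)
    moreover have "eventually (\<lambda>n. C < norm (x 0 + of_nat n * (d 0 / p))) sequentially"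
      using lim by (simp add: filterlim_at_top_dense)
    ultimately have "eventually (\<lambda>n. False) sequentially"
      by eventually_elim
        (use \<open>p \<noteq> 0\<close> in \<open>subst (asm) x_pow, simp add: norm_mult mult.commute\<close>)
    then show False by simp
  qed
  then show ?thesis using x[of n] d_pow[of n] by simp
qed

lemma second_order_recurrence_solution_geometric:
  fixes y :: "nat \<Rightarrow> 'c :: real_normed_field"
  assumes "p \<noteq> 0" "w = p \<or> norm p < norm w" and bigo: "y \<in> O(\<lambda>n. p ^ n)"
    and y: "\<And>n. shift_op [:- p, 1:] (shift_op [:- w, 1:] y) n = 0"
  shows "shift_op [:- p, 1:] y n = 0"
proof -
  define d where "d = shift_op [:- p, 1:] y"
  have d: "d (Suc n) = w * d n" for n
    using y[of n] by (simp add: d_def shift_op_pCons algebra_simps)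
  have "d n = 0"
  proof (cases "w = p")
    case True
    have "y (Suc n) = p * y n"
    proof (rule geometric_if_double_root_bigo[OF \<open>p \<noteq> 0\<close> bigo])
      show "y (Suc n) = p * y n + d n" for n by (simp add: d_def shift_op_pCons)
      show "d (Suc n) = p * d n" for n using d True by simp
    qed
    then show ?thesis by (simp add: d_def shift_op_pCons)
  next
    case False
    have "d \<in> O(\<lambda>n. p ^ n)" unfolding d_def using bigo by (rule shift_op_in_bigo_geometric)
    then show ?thesis using geometric_eq_0_if_bigo_smaller d False assms(2) by blast
  qed
  then show ?thesis by (simp add: d_def)
qed

lemma recurrence_solution_geometric:
  fixes p :: complex
  assumes "p \<noteq> 0" "q \<noteq> 0" "\<And>w. poly q w = 0 \<Longrightarrow> w = p \<or> cmod p < cmod w"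
    and "\<And>n. shift_op q y n = 0" "y \<in> O(\<lambda>n. p ^ n)"
  shows "shift_op [:- p, 1:] y n = 0"
  using assms(2-)
proof (induction "degree q" arbitrary: q y n)
  case 0
  then obtain a where "q = [:a:]" "a \<noteq> 0" by (metis degree_eq_zeroE pCons_eq_0_iff)
  then have "y n = 0" for n using 0(4)[of n] by (simp add: shift_op_pCons)
  then show ?case by (simp add: shift_op_pCons)
next
  case (Suc k)
  obtain w where w: "poly q w = 0"
    using fundamental_theorem_of_algebra[of q] Suc.hyps(2) constant_degree[of q] by auto
  then obtain r where q: "q = [:- w, 1:] * r" using poly_eq_0_iff_dvd by blast
  then have "r \<noteq> 0" using Suc.prems by auto
  then have deg: "k = degree r" using Suc.hyps(2) unfolding q by (subst (asm) degree_mult_eq) auto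
  have "shift_op [:- p, 1:] (shift_op [:- w, 1:] y) n = 0" for n
  proof (rule Suc.hyps(1)[OF deg \<open>r \<noteq> 0\<close>])
    show "v = p \<or> cmod p < cmod v" if "poly r v = 0" for v
      using Suc.prems(2)[of v] that by (simp add: q)
    show "shift_op r (shift_op [:- w, 1:] y) n = 0" for n
      using Suc.prems(3)[of n] shift_op_mult[of r "[:- w, 1:]"] by (simp add: q mult.commute)
    show "shift_op [:- w, 1:] y \<in> O(\<lambda>n. p ^ n)"
      by (rule shift_op_in_bigo_geometric[OF Suc.prems(4)])
  qed
  then show ?case
    using second_order_recurrence_solution_geometric[OF \<open>p \<noteq> 0\<close> Suc.prems(2)[OF w] Suc.prems(4)]
    by blast
qed

section \<open>Sums and submultiplicative sequences\<close>

lemma has_sum_sum: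
  fixes f :: "'b \<Rightarrow> 'a \<Rightarrow> 'c :: topological_comm_monoid_add"
  assumes "\<And>c. c \<in> C \<Longrightarrow> (f c has_sum s c) A"
  shows "((\<lambda>x. \<Sum>c\<in>C. f c x) has_sum (\<Sum>c\<in>C. s c)) A"
  using assms by (induction C rule: infinite_finite_induct) (auto intro: has_sum_add)

lemma summable_submultiplicative:
  fixes b :: "nat \<Rightarrow> real"
  assumes nonneg: "\<And>n. 0 \<le> b n" and submult: "\<And>m n. b (m + n) \<le> b m * b n" and "b N < 1"
  shows "summable b"
proof (rule summableI_nonneg_bounded)
  fix n
  have "(\<Sum>i<n. b i) \<le> (\<Sum>i<N + n. b i)" using nonneg by (intro sum_mono2) auto
  also have "\<dots> = (\<Sum>i<N. b i) + (\<Sum>i<n. b (N + i))"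
    using sum.atLeastLessThan_concat[of 0 N "N + n" b] sum.shift_bounds_nat_ivl[of b 0 N n]
    by (simp add: lessThan_atLeast0 add.commute)
  also have "(\<Sum>i<n. b (N + i)) \<le> b N * (\<Sum>i<n. b i)"
    unfolding sum_distrib_left by (intro sum_mono submult)
  finally have "(\<Sum>i<n. b i) * (1 - b N) \<le> (\<Sum>i<N. b i)" by (simp add: algebra_simps)
  then show "(\<Sum>i<n. b i) \<le> (\<Sum>i<N. b i) / (1 - b N)" using \<open>b N < 1\<close> by (simp add: field_simps)
qed (rule nonneg)

lemma submultiplicative_less_conv_radius:
  fixes a :: "nat \<Rightarrow> real"
  assumes nonneg: "\<And>n. 0 \<le> a n" and submult: "\<And>m n. a (m + n) \<le> a m * a n"
    and "0 \<le> r" "a N * r ^ N < 1"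
  shows "ereal r < conv_radius a"
proof -
  have "((\<lambda>x. a N * x ^ N) \<longlongrightarrow> a N * r ^ N) (at_right r)" by (intro tendsto_intros)
  then have "eventually (\<lambda>x. a N * x ^ N < 1 \<and> r < x) (at_right r)"
    using order_tendstoD(2) assms(4) eventually_at_right_less by (intro eventually_conj) auto
  then obtain x where x: "a N * x ^ N < 1" "r < x"
    using eventually_happens'[OF trivial_limit_at_right_real] by blast
  have "summable (\<lambda>n. a n * x ^ n)"
  proof (rule summable_submultiplicative)
    show "a (m + n) * x ^ (m + n) \<le> a m * x ^ m * (a n * x ^ n)" for m n
      using mult_right_mono[OF submult[of m n], of "x ^ m * x ^ n"] x(2) \<open>0 \<le> r\<close>
      by (simp add: power_add mult_ac)
    show "a N * x ^ N < 1" by (rule x(1))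
  qed (use nonneg x(2) \<open>0 \<le> r\<close> in auto)
  then have "ereal x \<le> conv_radius a" using conv_radius_geI[of a x] x(2) \<open>0 \<le> r\<close> by simp
  then show ?thesis using x(2) by (meson less_ereal.simps(1) less_le_trans)
qed

section \<open>Finitely additive probabilities\<close>

definition prob_charge :: "('b set \<Rightarrow> real) \<Rightarrow> bool" where
  "prob_charge \<nu> \<longleftrightarrow> (\<forall>A. 0 \<le> \<nu> A) \<and> (\<forall>A B. A \<inter> B = {} \<longrightarrow> \<nu> (A \<union> B) = \<nu> A + \<nu> B) \<and> \<nu> UNIV = 1"

lemma prob_charge_nonneg: "prob_charge \<nu> \<Longrightarrow> 0 \<le> \<nu> A"
  and prob_charge_Un: "prob_charge \<nu> \<Longrightarrow> A \<inter> B = {} \<Longrightarrow> \<nu> (A \<union> B) = \<nu> A + \<nu> B"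
  and prob_charge_UNIV: "prob_charge \<nu> \<Longrightarrow> \<nu> UNIV = 1"
  by (auto simp: prob_charge_def)

lemma prob_charge_empty: "prob_charge \<nu> \<Longrightarrow> \<nu> {} = 0"
  using prob_charge_Un[of \<nu> "{}" "{}"] by simp

lemma prob_charge_Compl: "prob_charge \<nu> \<Longrightarrow> \<nu> (- A) = 1 - \<nu> A"
  using prob_charge_Un[of \<nu> A "- A"] prob_charge_UNIV[of \<nu>] by simp

lemma prob_charge_le_1: "prob_charge \<nu> \<Longrightarrow> \<nu> A \<le> 1"
  using prob_charge_Compl[of \<nu> A] prob_charge_nonneg[of \<nu> "- A"] by simp

lemma prob_charge_mono: "prob_charge \<nu> \<Longrightarrow> A \<subseteq> B \<Longrightarrow> \<nu> A \<le> \<nu> B"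
  using prob_charge_Un[of \<nu> A "B - A"] prob_charge_nonneg[of \<nu> "B - A"] by (simp add: Un_absorb1)

lemma prob_charge_vimage: "prob_charge \<nu> \<Longrightarrow> prob_charge (\<lambda>A. \<nu> (f -` A))"
  by (simp add: prob_charge_def vimage_Un flip: vimage_Int)

lemma compact_PiE_UNIV:
  fixes K :: "'b \<Rightarrow> 'c :: topological_space set"
  assumes "\<And>b. compact (K b)"
  shows "compact (PiE UNIV K)"
proof -
  have "compactin (product_topology (\<lambda>_. euclidean) UNIV) (PiE UNIV K)"
    unfolding compactin_PiE using assms by simp
  then show ?thesis by (simp add: euclidean_product_topology)
qed

lemma pointwise_cluster_point:
  fixes m :: "'i \<Rightarrow> 'b \<Rightarrow> 'c :: topological_space"
  assumes "F \<noteq> bot" and compact: "\<And>b. compact (K b)" and m: "eventually (\<lambda>i. \<forall>b. m i b \<in> K b) F"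
  obtains H \<nu> where "H \<noteq> bot" "H \<le> filtermap m F" "\<And>b. ((\<lambda>g. g b) \<longlongrightarrow> \<nu> b) H"
proof -
  have "compact (PiE UNIV K)" using compact by (rule compact_PiE_UNIV)
  moreover have "eventually (\<lambda>g. g \<in> PiE UNIV K) (filtermap m F)"
    using m by (simp add: eventually_filtermap PiE_iff)
  moreover have "filtermap m F \<noteq> bot" using \<open>F \<noteq> bot\<close> by (simp add: filtermap_bot_iff)
  ultimately obtain \<nu> where \<nu>: "inf (nhds \<nu>) (filtermap m F) \<noteq> bot"
    unfolding compact_filter by blast
  have "((\<lambda>g. g b) \<longlongrightarrow> \<nu> b) (at \<nu>)" for b
    using continuous_on_product_coordinates[of b] unfolding continuous_on_def by blast
  then have "((\<lambda>g. g b) \<longlongrightarrow> \<nu> b) (nhds \<nu>)" for b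
    using tendsto_at_iff_tendsto_nhds[of "\<lambda>g. g b" \<nu>] by simp
  then have "((\<lambda>g. g b) \<longlongrightarrow> \<nu> b) (inf (nhds \<nu>) (filtermap m F))" for b
    using tendsto_mono[OF inf_le1] by blast
  then show thesis by (rule that[OF \<nu> inf_le2])
qed

lemma prob_charge_cluster_point:
  assumes "F \<noteq> bot" and m: "eventually (\<lambda>i. prob_charge (m i)) F"
  obtains \<nu> where "prob_charge \<nu>" "\<And>A L. ((\<lambda>i. m i A) \<longlongrightarrow> L) F \<Longrightarrow> \<nu> A = L"
proof -
  have "eventually (\<lambda>i. \<forall>A. m i A \<in> {0..1}) F"
    using m by eventually_elim (auto simp: prob_charge_nonneg prob_charge_le_1)
  then obtain H \<nu> where H: "H \<noteq> bot" "H \<le> filtermap m F" and \<nu>: "\<And>A. ((\<lambda>g. g A) \<longlongrightarrow> \<nu> A) H"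
    by (rule pointwise_cluster_point[OF \<open>F \<noteq> bot\<close> compact_Icc]) blast
  have charge: "eventually prob_charge H"
    using m by (intro filter_leD[OF H(2)]) (simp add: eventually_filtermap)
  have "prob_charge \<nu>"
    unfolding prob_charge_def
  proof (intro conjI allI impI)
    fix A
    show "0 \<le> \<nu> A"
      using charge by (intro tendsto_lowerbound[OF \<nu> _ H(1)])
        (auto elim: eventually_mono simp: prob_charge_nonneg)
  next
    fix A B :: "'b set" assume "A \<inter> B = {}"
    then have "eventually (\<lambda>g. g A + g B = g (A \<union> B)) H"
      using charge by (auto elim: eventually_mono simp: prob_charge_Un)
    then have "((\<lambda>g. g (A \<union> B)) \<longlongrightarrow> \<nu> A + \<nu> B) H"
      by (rule Lim_transform_eventually[OF tendsto_add[OF \<nu> \<nu>]])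
    then show "\<nu> (A \<union> B) = \<nu> A + \<nu> B" using tendsto_unique[OF H(1) \<nu>] by blast
  next
    have "((\<lambda>g. g UNIV) \<longlongrightarrow> 1) H"
      using charge by (intro tendsto_eventually) (auto elim: eventually_mono simp: prob_charge_UNIV)
    then show "\<nu> UNIV = 1" using tendsto_unique[OF H(1) \<nu>] by blast
  qed
  moreover have "\<nu> A = L" if "((\<lambda>i. m i A) \<longlongrightarrow> L) F" for A L
  proof -
    have "((\<lambda>g. g A) \<longlongrightarrow> L) (filtermap m F)" using that by (simp add: filterlim_filtermap)
    then show ?thesis using tendsto_unique[OF H(1) \<nu>] tendsto_mono[OF H(2)] by blast
  qed
  ultimately show thesis using that by blast
qed

definition clopen :: "'b :: topological_space set \<Rightarrow> bool" where
  "clopen A \<longleftrightarrow> open A \<and> closed A"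

lemma clopen_Collect_imp: "clopen {x. P x} \<Longrightarrow> clopen {x. Q x} \<Longrightarrow> clopen {x. P x \<longrightarrow> Q x}"
  by (simp add: clopen_def open_Collect_imp closed_Collect_imp)

lemma clopen_Collect_conj: "clopen {x. P x} \<Longrightarrow> clopen {x. Q x} \<Longrightarrow> clopen {x. P x \<and> Q x}"
  by (simp add: clopen_def open_Collect_conj closed_Collect_conj)

lemma clopen_Collect_bex:
  assumes "finite W" "\<And>w. w \<in> W \<Longrightarrow> clopen {x. P w x}"
  shows "clopen {x. \<exists>w\<in>W. P w x}"
proof -
  have "{x. \<exists>w\<in>W. P w x} = (\<Union>w\<in>W. {x. P w x})" by auto
  then show ?thesis using assms by (simp add: clopen_def open_UN closed_UN)
qed

lemma clopen_Collect_coordinate: "clopen {x :: 'b \<Rightarrow> bool. x i}"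
proof -
  have "clopen {True}"
    by (simp add: clopen_def discrete_topology_class.open_discrete closed_def)
  then have "clopen ((\<lambda>x :: 'b \<Rightarrow> bool. x i) -` {True})"
    by (simp add: clopen_def open_vimage closed_vimage)
  then show ?thesis by (simp add: vimage_def)
qed

lemmas clopen_Collect_intros =
  clopen_Collect_imp clopen_Collect_conj clopen_Collect_bex clopen_Collect_coordinate

lemma compact_UNIV_fun:
  assumes "compact (UNIV :: 'c :: topological_space set)"
  shows "compact (UNIV :: ('b \<Rightarrow> 'c) set)"
  using compact_PiE_UNIV[of "\<lambda>_ :: 'b. UNIV :: 'c set"] assms by (simp add: PiE_UNIV_domain)

lemma algebra_clopen: "algebra UNIV {A :: 'b :: topological_space set. clopen A}"
  unfolding algebra_iff_Un by (auto simp: clopen_def Compl_eq_Diff_UNIV[symmetric])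

lemma compact_decseq_closed_empty:
  fixes A :: "nat \<Rightarrow> 'b :: topological_space set"
  assumes "compact (UNIV :: 'b set)" "decseq A" "\<And>n. closed (A n)" "(\<Inter>n. A n) = {}"
  shows "\<exists>n. A n = {}"
proof (rule ccontr)
  assume nonempty: "\<nexists>n. A n = {}"
  have "UNIV \<inter> (\<Inter>n\<in>UNIV. A n) \<noteq> {}"
  proof (rule compact_imp_fip_image[OF assms(1,3)])
    fix K :: "nat set" assume "finite K"
    then have "A (Max (insert 0 K)) \<subseteq> A n" if "n \<in> K" for n
      using that by (intro decseqD[OF assms(2)] Max_ge) auto
    then show "UNIV \<inter> (\<Inter>n\<in>K. A n) \<noteq> {}" using nonempty by blast
  qed
  then show False using assms(4) by simp
qed

lemma ex_prob_space_eq_charge_on_clopen: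
  fixes \<nu> :: "'b :: topological_space set \<Rightarrow> real"
  assumes "compact (UNIV :: 'b set)" and \<nu>: "prob_charge \<nu>"
  obtains N where "prob_space N" "space N = UNIV" "\<And>A. clopen A \<Longrightarrow> A \<in> sets N"
    "\<And>A. clopen A \<Longrightarrow> measure N A = \<nu> A"
proof -
  let ?C = "{A :: 'b set. clopen A}"
  interpret algebra UNIV ?C by (rule algebra_clopen)
  have "\<exists>\<mu> :: 'b set \<Rightarrow> ennreal. (\<forall>A\<in>?C. \<mu> A = ennreal (\<nu> A)) \<and>
      measure_space UNIV (sigma_sets UNIV ?C) \<mu>"
  proof (rule caratheodory_empty_continuous)
    show "positive ?C (\<lambda>A. ennreal (\<nu> A))" by (simp add: positive_def prob_charge_empty[OF \<nu>])
    show "additive ?C (\<lambda>A. ennreal (\<nu> A))"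
      by (simp add: additive_def prob_charge_Un[OF \<nu>] prob_charge_nonneg[OF \<nu>])
  next
    fix A :: "nat \<Rightarrow> 'b set"
    assume A: "range A \<subseteq> ?C" "decseq A" "(\<Inter>n. A n) = {}"
    have "closed (A n)" for n using A(1) by (auto simp: clopen_def)
    then obtain n where "A n = {}"
      using compact_decseq_closed_empty[OF assms(1) A(2) _ A(3)] by blast
    then have "A k = {}" if "n \<le> k" for k using decseqD[OF A(2) that] by simp
    then have "eventually (\<lambda>k. ennreal (\<nu> (A k)) = 0) sequentially"
      unfolding eventually_sequentially by (metis ennreal_0 prob_charge_empty[OF \<nu>])
    then show "(\<lambda>k. ennreal (\<nu> (A k))) \<longlonglongrightarrow> 0" by (rule tendsto_eventually)
  qed simp
  then obtain \<mu> where \<mu>: "\<And>A. clopen A \<Longrightarrow> \<mu> A = ennreal (\<nu> A)"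
    "measure_space UNIV (sigma_sets UNIV ?C) \<mu>" by blast
  define N where "N = measure_of UNIV (sigma_sets UNIV ?C) \<mu>"
  have emeasure_N: "emeasure N A = ennreal (\<nu> A)" if "clopen A" for A
    using \<mu>(2) \<mu>(1)[OF that] that unfolding N_def measure_space_def
    by (subst emeasure_measure_of_sigma) auto
  show thesis
  proof (rule that[of N])
    show "prob_space N"
      using emeasure_N[of UNIV]
      by (intro prob_spaceI) (simp add: N_def clopen_def prob_charge_UNIV[OF \<nu>])
    show "A \<in> sets N" if "clopen A" for A using that by (simp add: N_def sigma_sets.Basic)
    show "measure N A = \<nu> A" if "clopen A" for A
      using emeasure_N[OF that] prob_charge_nonneg[OF \<nu>] by (simp add: measure_def)
  qed (simp add: N_def)
qed

section \<open>Words modulo commutation\<close>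

definition proj :: "'a \<Rightarrow> 'a \<Rightarrow> 'a list \<Rightarrow> 'a list" where
  "proj x y w = filter (\<lambda>a. a = x \<or> a = y) w"

lemma proj_Nil [simp]: "proj x y [] = []"
  and proj_Cons [simp]: "proj x y (a # u) = (if a = x \<or> a = y then a # proj x y u else proj x y u)"
  and proj_append [simp]: "proj x y (u @ v) = proj x y u @ proj x y v"
  by (auto simp: proj_def)

lemma set_proj [simp]: "set (proj x y u) = set u \<inter> {x, y}"
  by (auto simp: proj_def)

lemma proj_commute: "proj x y u = proj y x u"
  by (simp add: proj_def disj_commute)

lemma proj_eq_Nil_iff [simp]: "proj x y u = [] \<longleftrightarrow> x \<notin> set u \<and> y \<notin> set u"
  by (auto simp: proj_def filter_empty_conv)

lemma count_list_proj: "z = x \<or> z = y \<Longrightarrow> count_list (proj x y u) z = count_list u z"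
  by (induction u) auto

locale independence =
  fixes I :: "('a \<times> 'a) set"
  assumes irrefl_I: "irrefl I" and sym_I: "sym I"
begin

abbreviation trace_equiv :: "'a list \<Rightarrow> 'a list \<Rightarrow> bool" (infix \<open>\<simeq>\<close> 50) where
  "u \<simeq> v \<equiv> trace_eq I u v"

definition word_le :: "'a list \<Rightarrow> 'a list \<Rightarrow> bool" (infix \<open>\<preceq>\<close> 50) where
  "u \<preceq> v \<longleftrightarrow> (\<forall>x y. (x, y) \<notin> I \<longrightarrow> prefix (proj x y u) (proj x y v))"

lemma not_indep_refl [simp]: "(a, a) \<notin> I"
  using irrefl_I by (auto simp: irrefl_def)

lemma indep_sym: "(a, b) \<in> I \<Longrightarrow> (b, a) \<in> I"
  using sym_I by (auto simp: sym_def)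

lemmas [trans] = trace_eq.trans

lemma trace_eq_Cons: "u \<simeq> v \<Longrightarrow> a # u \<simeq> a # v"
  using trace_eq.cong[OF trace_eq.refl, of I u v "[a]"] by simp

lemma trace_eq_imp_proj_eq: "u \<simeq> v \<Longrightarrow> (x, y) \<notin> I \<Longrightarrow> proj x y u = proj x y v"
proof (induction rule: trace_eq.induct)
  case (comm a b)
  then show ?case using indep_sym[of a b] by auto
qed auto

lemma word_leD: "u \<preceq> v \<Longrightarrow> (x, y) \<notin> I \<Longrightarrow> prefix (proj x y u) (proj x y v)"
  by (simp add: word_le_def)

lemma word_le_refl [simp]: "u \<preceq> u"
  by (simp add: word_le_def)

lemma Nil_word_le [simp]: "[] \<preceq> u"
  by (simp add: word_le_def)

lemma word_le_trans [trans]: "u \<preceq> v \<Longrightarrow> v \<preceq> w \<Longrightarrow> u \<preceq> w"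
  unfolding word_le_def by (meson prefix_order.trans)

lemma word_le_append_cancel [simp]: "w @ u \<preceq> w @ v \<longleftrightarrow> u \<preceq> v"
  by (simp add: word_le_def)

lemma word_le_Cons_cancel [simp]: "a # u \<preceq> a # v \<longleftrightarrow> u \<preceq> v"
  using word_le_append_cancel[of "[a]" u v] by simp

lemma word_le_append [simp]: "u \<preceq> u @ v"
  by (simp add: word_le_def)

lemma letter_le_Cons [simp]: "[a] \<preceq> a # u"
  using word_le_append[of "[a]" u] by simp

lemma trace_eq_imp_word_le: "u \<simeq> v \<Longrightarrow> u \<preceq> v"
  by (simp add: word_le_def trace_eq_imp_proj_eq)

lemma word_le_cong_left: "u \<simeq> v \<Longrightarrow> u \<preceq> t \<longleftrightarrow> v \<preceq> t"
  and word_le_cong_right: "u \<simeq> v \<Longrightarrow> t \<preceq> u \<longleftrightarrow> t \<preceq> v"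
  using trace_eq_imp_proj_eq[of u v] by (auto simp: word_le_def)

lemma set_mono_word_le:
  assumes "u \<preceq> v"
  shows "set u \<subseteq> set v"
proof
  fix x assume "x \<in> set u"
  moreover have "set (proj x x u) \<subseteq> set (proj x x v)"
    by (rule set_mono_prefix[OF word_leD[OF assms not_indep_refl]])
  ultimately show "x \<in> set v" by auto
qed

lemma proj_eq_Cons_of_letter_le:
  assumes "[a] \<preceq> t" "(a, b) \<notin> I"
  shows "\<exists>s. proj a b t = a # s"
  using word_leD[OF assms] by (auto simp: prefix_def)

lemma word_le_Cons_indep:
  assumes indep: "\<And>b. b \<in> set v \<Longrightarrow> (a, b) \<in> I"
  shows "v \<preceq> a # s \<longleftrightarrow> v \<preceq> s"
proof -
  have "prefix (proj x y v) (proj x y (a # s)) \<longleftrightarrow> prefix (proj x y v) (proj x y s)"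
    if xy: "(x, y) \<notin> I" for x y
  proof (cases "a = x \<or> a = y")
    case True
    then have "x \<notin> set v" "y \<notin> set v"
      using indep[of x] indep[of y] xy indep_sym not_indep_refl by blast+
    then have "proj x y v = []" by simp
    then show ?thesis by (simp only: Nil_prefix)
  qed simp
  then show ?thesis by (simp add: word_le_def)
qed

lemma letter_le_imp_trace_eq_Cons: "[a] \<preceq> t \<Longrightarrow> \<exists>s. t \<simeq> a # s"
proof (induction t)
  case Nil
  then show ?case using set_mono_word_le[of "[a]" "[]"] by simp
next
  case (Cons b t)
  show ?case
  proof (cases "a = b")
    case True
    then show ?thesis using trace_eq.refl by blast
  next
    case False
    then have "(b, a) \<in> I"
      using proj_eq_Cons_of_letter_le[OF Cons.prems, of b] indep_sym by fastforce
    then have "[a] \<preceq> t" using Cons.prems word_le_Cons_indep[of "[a]" b t] by simp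
    then obtain s where "t \<simeq> a # s" using Cons.IH by blast
    then have "b # t \<simeq> b # a # s" by (rule trace_eq_Cons)
    also have "b # a # s \<simeq> a # b # s"
      using trace_eq.cong[OF trace_eq.comm[OF \<open>(b, a) \<in> I\<close>] trace_eq.refl[of I s]] by simp
    finally show ?thesis by blast
  qed
qed

lemma Cons_word_leE:
  assumes "a # u \<preceq> t"
  obtains s where "t \<simeq> a # s" "u \<preceq> s"
proof -
  obtain s where "t \<simeq> a # s"
    using letter_le_imp_trace_eq_Cons word_le_trans[OF letter_le_Cons assms] by blast
  then show thesis using that assms word_le_cong_right[of t "a # s"] by simp
qed

lemma word_le_imp_factor: "u \<preceq> t \<Longrightarrow> \<exists>z. t \<simeq> u @ z"
proof (induction u arbitrary: t)
  case Nil
  show ?case by (auto intro: trace_eq.refl)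
next
  case (Cons a u)
  obtain s where s: "t \<simeq> a # s" "u \<preceq> s" using Cons.prems by (rule Cons_word_leE)
  then obtain z where "s \<simeq> u @ z" using Cons.IH by blast
  then have "a # s \<simeq> a # u @ z" by (rule trace_eq_Cons)
  with s(1) show ?case by (auto intro: trace_eq.trans)
qed

lemma word_le_iff_factor: "u \<preceq> t \<longleftrightarrow> (\<exists>z. t \<simeq> u @ z)"
  using word_le_imp_factor word_le_append word_le_cong_right by blast

lemma word_le_imp_length_le: "u \<preceq> v \<Longrightarrow> length u \<le> length v"
  using trace_eq_length by (fastforce simp: word_le_iff_factor)

lemma word_le_imp_trace_eq:
  assumes "u \<preceq> v" "length v \<le> length u"
  shows "u \<simeq> v"
proof -
  obtain z where z: "v \<simeq> u @ z" using assms(1) word_le_imp_factor by blast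
  then have "z = []" using trace_eq_length[OF z] assms(2) by simp
  then show ?thesis using z by (simp add: trace_eq.sym)
qed

lemma trace_eq_iff_proj: "u \<simeq> v \<longleftrightarrow> (\<forall>x y. (x, y) \<notin> I \<longrightarrow> proj x y u = proj x y v)"
proof
  assume "\<forall>x y. (x, y) \<notin> I \<longrightarrow> proj x y u = proj x y v"
  then have "u \<preceq> v" "v \<preceq> u" by (auto simp: word_le_def)
  then show "u \<simeq> v" by (simp add: word_le_imp_length_le word_le_imp_trace_eq)
qed (simp add: trace_eq_imp_proj_eq)

lemma trace_eq_append_cancel_left: "w @ u \<simeq> w @ v \<longleftrightarrow> u \<simeq> v"
  and trace_eq_append_cancel_right: "u @ w \<simeq> v @ w \<longleftrightarrow> u \<simeq> v"
  by (simp_all add: trace_eq_iff_proj)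

lemma letter_le_or_indep:
  assumes a: "[a] \<preceq> t" and v: "v \<preceq> t"
  shows "[a] \<preceq> v \<or> (\<forall>b\<in>set v. (a, b) \<in> I)"
proof (rule disjCI)
  assume "\<not> (\<forall>b\<in>set v. (a, b) \<in> I)"
  then obtain b where b: "b \<in> set v" "(a, b) \<notin> I" by blast
  have proj_v: "\<exists>s. proj a c v = a # s"
    if dep: "(a, c) \<notin> I" and mem: "a \<in> set v \<or> c \<in> set v" for c
  proof -
    have "proj a c v \<noteq> []" using mem by simp
    moreover obtain s where "proj a c t = a # s"
      using proj_eq_Cons_of_letter_le[OF a dep] by blast
    ultimately show ?thesis using word_leD[OF v dep] by (auto simp: prefix_Cons)
  qed
  obtain s where "proj a b v = a # s" using proj_v b by blast
  then have "a \<in> set (proj a b v)" by simp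
  then have "a \<in> set v" by simp
  have "prefix (proj x y [a]) (proj x y v)" if dep: "(x, y) \<notin> I" for x y
  proof -
    have dep': "(y, x) \<notin> I" using dep indep_sym by blast
    consider (fst) "a = x" | (snd) "a = y" | (neither) "a \<noteq> x" "a \<noteq> y" by blast
    then show ?thesis
    proof cases
      case fst
      then show ?thesis using proj_v[of y] dep \<open>a \<in> set v\<close> by auto
    next
      case snd
      then show ?thesis
        using proj_v[of x] dep' \<open>a \<in> set v\<close> proj_commute[of y x v] by auto
    qed simp
  qed
  then show "[a] \<preceq> v" by (simp add: word_le_def)
qed

definition word_lub :: "'a list \<Rightarrow> 'a list \<Rightarrow> 'a list \<Rightarrow> bool" where
  "word_lub u v w \<longleftrightarrow> u \<preceq> w \<and> v \<preceq> w \<and> (\<forall>t. u \<preceq> t \<longrightarrow> v \<preceq> t \<longrightarrow> w \<preceq> t)"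

lemma word_lub_cong: "v \<simeq> v' \<Longrightarrow> word_lub u v w \<longleftrightarrow> word_lub u v' w"
  using word_le_cong_left[of v v'] by (simp add: word_lub_def)

lemma word_lub_Cons_Cons:
  assumes "word_lub u v w"
  shows "word_lub (a # u) (a # v) (a # w)"
proof -
  have "a # w \<preceq> t" if "a # u \<preceq> t" "a # v \<preceq> t" for t
  proof -
    obtain s where s: "t \<simeq> a # s" "u \<preceq> s" using \<open>a # u \<preceq> t\<close> by (rule Cons_word_leE)
    then have "v \<preceq> s" using word_le_cong_right \<open>a # v \<preceq> t\<close> word_le_Cons_cancel by blast
    then have "w \<preceq> s" using assms s(2) by (simp add: word_lub_def)
    then show ?thesis using word_le_cong_right[OF s(1)] by simp
  qed
  then show ?thesis using assms by (simp add: word_lub_def)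
qed

lemma word_lub_Cons_indep:
  assumes indep: "\<And>b. b \<in> set v \<Longrightarrow> (a, b) \<in> I" and lub: "word_lub u v w"
  shows "word_lub (a # u) v (a # w)"
proof -
  have "a # w \<preceq> t" if "a # u \<preceq> t" "v \<preceq> t" for t
  proof -
    obtain s where s: "t \<simeq> a # s" "u \<preceq> s" using \<open>a # u \<preceq> t\<close> by (rule Cons_word_leE)
    then have "v \<preceq> s" using word_le_cong_right \<open>v \<preceq> t\<close> word_le_Cons_indep[OF indep] by blast
    then have "w \<preceq> s" using lub s(2) by (simp add: word_lub_def)
    then show ?thesis using word_le_cong_right[OF s(1)] by simp
  qed
  then show ?thesis using lub word_le_Cons_indep[OF indep] by (simp add: word_lub_def)
qed

lemma ex_word_lub: "u \<preceq> t \<Longrightarrow> v \<preceq> t \<Longrightarrow> \<exists>w. word_lub u v w"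
proof (induction u arbitrary: v t)
  case Nil
  have "word_lub [] v v" by (simp add: word_lub_def)
  then show ?case ..
next
  case (Cons a u)
  obtain s where s: "t \<simeq> a # s" "u \<preceq> s" using Cons.prems(1) by (rule Cons_word_leE)
  have v: "v \<preceq> a # s" using Cons.prems(2) word_le_cong_right[OF s(1)] by simp
  consider (letter_le) "[a] \<preceq> v" | (indep) "\<forall>b\<in>set v. (a, b) \<in> I"
    using letter_le_or_indep[OF letter_le_Cons v] by blast
  then show ?case
  proof cases
    case letter_le
    then obtain v' where v': "v \<simeq> a # v'" using letter_le_imp_trace_eq_Cons by blast
    then have "v' \<preceq> s" using v word_le_cong_left[OF v'] by simp
    then obtain w where "word_lub u v' w" using Cons.IH s(2) by blast
    then show ?thesis using word_lub_Cons_Cons word_lub_cong[OF v'] by blast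
  next
    case indep
    then have "v \<preceq> s" using v word_le_Cons_indep by blast
    then obtain w where "word_lub u v w" using Cons.IH s(2) by blast
    then show ?thesis using word_lub_Cons_indep indep by blast
  qed
qed

abbreviation clique_word :: "'a list \<Rightarrow> bool" where
  "clique_word \<equiv> sorted_wrt (\<lambda>a b. (a, b) \<in> I)"

lemma clique_word_iff_nth:
  "clique_word w \<longleftrightarrow> (\<forall>i<length w. \<forall>j<length w. i \<noteq> j \<longrightarrow> (w ! i, w ! j) \<in> I)"
proof
  assume w: "clique_word w"
  show "\<forall>i<length w. \<forall>j<length w. i \<noteq> j \<longrightarrow> (w ! i, w ! j) \<in> I"
  proof (intro allI impI)
    fix i j assume "i < length w" "j < length w" "i \<noteq> j"
    then show "(w ! i, w ! j) \<in> I"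
      using sorted_wrt_nth_less[OF w] indep_sym by (cases i j rule: linorder_cases) auto
  qed
qed (simp add: sorted_wrt_iff_nth_less)

lemma clique_word_iff_set:
  "clique_word w \<longleftrightarrow> distinct w \<and> (\<forall>a\<in>set w. \<forall>b\<in>set w. a \<noteq> b \<longrightarrow> (a, b) \<in> I)"
  by (induction w) (auto dest: indep_sym)

lemma letter_le_clique_word_iff: "clique_word w \<Longrightarrow> [a] \<preceq> w \<longleftrightarrow> a \<in> set w"
proof (induction w)
  case Nil
  then show ?case using set_mono_word_le[of "[a]" "[]"] by auto
next
  case (Cons b w)
  then show ?case
    using word_le_Cons_indep[of "[a]" b w] set_mono_word_le[of "[a]" "b # w"] by auto
qed

lemma clique_word_leI: "clique_word w \<Longrightarrow> (\<And>a. a \<in> set w \<Longrightarrow> [a] \<preceq> t) \<Longrightarrow> w \<preceq> t"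
proof (induction w arbitrary: t)
  case Nil
  then show ?case by simp
next
  case (Cons a w)
  have "[a] \<preceq> t" using Cons.prems(2) by simp
  then obtain s where s: "t \<simeq> a # s" using letter_le_imp_trace_eq_Cons by blast
  have "[b] \<preceq> s" if "b \<in> set w" for b
    using Cons.prems that word_le_cong_right[OF s] word_le_Cons_indep[of "[b]" a s] by auto
  then have "w \<preceq> s" using Cons by simp
  then show ?case using word_le_cong_right[OF s] by simp
qed

lemma letters_le_imp_indep: "[a] \<preceq> t \<Longrightarrow> [b] \<preceq> t \<Longrightarrow> a \<noteq> b \<Longrightarrow> (a, b) \<in> I"
  using letter_le_or_indep[of a t "[b]"] set_mono_word_le[of "[a]" "[b]"] by auto

section \<open>Walks in the dependence graph\<close>

abbreviation dependence_walk :: "'a list \<Rightarrow> bool" where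
  "dependence_walk \<equiv> successively (\<lambda>x y. (x, y) \<notin> I)"

lemma prefix_proj_append_if_count_le:
  assumes "u @ w \<preceq> t" "v @ w \<preceq> t" "(x, y) \<notin> I" "x \<in> set w \<or> y \<in> set w"
    and count: "count_list u (last (proj x y w)) \<le> count_list v (last (proj x y w))"
  shows "prefix (proj x y (u @ w)) (proj x y (v @ w))"
proof (rule prefix_if_count_last_le)
  show "prefix (proj x y (u @ w)) (proj x y t)" "prefix (proj x y (v @ w)) (proj x y t)"
    using assms(1-3) word_leD by blast+
  have nonempty: "proj x y w \<noteq> []" using assms(4) by auto
  then show "proj x y (u @ w) \<noteq> []" by simp
  have "last (proj x y w) \<in> {x, y}" using last_in_set[OF nonempty] by auto
  then show "count_list (proj x y (u @ w)) (last (proj x y (u @ w)))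
      \<le> count_list (proj x y (v @ w)) (last (proj x y (u @ w)))"
    using count nonempty by (auto simp: count_list_proj)
qed

text \<open>Going backwards along the walk, the bound on the number of occurrences passes from a letter to
  its predecessor: the last letter of the projection to these two letters is the later one.\<close>

lemma dependence_walk_count_le:
  assumes walk: "dependence_walk w" and le: "u @ w \<preceq> t" "v @ w \<preceq> t"
    and count: "count_list u (last w) \<le> count_list v (last w)" and "x \<in> set w"
  shows "count_list u x \<le> count_list v x"
proof -
  have "\<forall>x\<in>set w''. count_list u x \<le> count_list v x" if "w = w' @ w''" for w' w''
    using that
  proof (induction w'' arbitrary: w')
    case (Cons x w'')
    have suffix: "\<forall>y\<in>set w''. count_list u y \<le> count_list v y"
      using Cons.IH[of "w' @ [x]"] Cons.prems by simp
    moreover have "count_list u x \<le> count_list v x" if "x \<notin> set w''"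
    proof (cases w'')
      case Nil
      then show ?thesis using count Cons.prems by simp
    next
      case w'': (Cons y ys)
      have dep: "(x, y) \<notin> I" using walk Cons.prems by (simp add: w'' successively_append_iff)
      have nonempty: "proj x y w'' \<noteq> []" by (simp add: w'')
      have "last (proj x y w'') = y"
        using last_in_set[OF nonempty] \<open>x \<notin> set w''\<close> by auto
      then have "last (proj x y w) = y" using Cons.prems nonempty by auto
      then have "prefix (proj x y (u @ w)) (proj x y (v @ w))"
        using Cons.prems suffix w'' by (intro prefix_proj_append_if_count_le[OF le dep]) auto
      then have "count_list (proj x y (u @ w)) x \<le> count_list (proj x y (v @ w)) x"
        by (auto simp: prefix_def simp del: proj_append)
      then show ?thesis by (simp add: count_list_proj)
    qed
    ultimately show ?case by auto
  qed simp
  from this[of "[]" w] show ?thesis using \<open>x \<in> set w\<close> by simp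
qed

lemma append_walk_le_append_walk:
  assumes walk: "dependence_walk w" and le: "u @ w \<preceq> t" "v @ w \<preceq> t"
    and letters: "set u \<subseteq> set w" "set v \<subseteq> set w"
    and count: "count_list u (last w) \<le> count_list v (last w)"
  shows "u @ w \<preceq> v @ w"
  unfolding word_le_def
proof (intro allI impI)
  fix x y assume dep: "(x, y) \<notin> I"
  show "prefix (proj x y (u @ w)) (proj x y (v @ w))"
  proof (cases "x \<in> set w \<or> y \<in> set w")
    case True
    then have "proj x y w \<noteq> []" by auto
    then have "last (proj x y w) \<in> set (proj x y w)" by (rule last_in_set)
    then have "last (proj x y w) \<in> set w" by simp
    then show ?thesis
      using dependence_walk_count_le[OF walk le count] True
      by (intro prefix_proj_append_if_count_le[OF le dep]) auto
  next
    case False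
    then have "proj x y (u @ w) = []" using letters by auto
    then show ?thesis by (simp only: Nil_prefix)
  qed
qed

lemma append_walk_inj:
  assumes "dependence_walk w" "u @ w \<preceq> t" "v @ w \<preceq> t" "set u \<subseteq> set w" "set v \<subseteq> set w"
    and "length u = length v"
  shows "u \<simeq> v"
proof -
  have "u @ w \<preceq> v @ w \<or> v @ w \<preceq> u @ w"
    using append_walk_le_append_walk[OF assms(1-5)] append_walk_le_append_walk[OF assms(1,3,2,5,4)]
    by linarith
  then have "u @ w \<simeq> v @ w"
    using word_le_imp_trace_eq[of "u @ w" "v @ w"] word_le_imp_trace_eq[of "v @ w" "u @ w"]
    by (auto simp: assms(6) intro: trace_eq.sym)
  then show ?thesis by (simp add: trace_eq_append_cancel_right)
qed

end

section \<open>The trace monoid\<close>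

locale trace_pair =
  fixes S :: "'a set" and I :: "('a \<times> 'a) set"
  assumes indep_pair: "independence_pair S I"
begin

sublocale independence I
  using indep_pair by unfold_locales (auto simp: independence_pair_def)

abbreviation "M \<equiv> trace_monoid S I"
abbreviation "traces \<equiv> carrier M"
abbreviation "cls \<equiv> trace_of S I"
abbreviation trace_mult (infixl \<open>\<odot>\<close> 70) where "u \<odot> v \<equiv> u \<otimes>\<^bsub>M\<^esub> v"
abbreviation trace_le (infix \<open>\<unlhd>\<close> 50) where "u \<unlhd> v \<equiv> u divides\<^bsub>M\<^esub> v"
abbreviation empty_trace (\<open>\<epsilon>\<close>) where "\<epsilon> \<equiv> \<one>\<^bsub>M\<^esub>"
abbreviation "len \<equiv> trace_length"

declare trace_mult_trace_of [simp] trace_length_trace_of [simp]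

declare in_lists_conv_set [simp del] in_listsD [rule del] in_listsI [rule del]

lemma finite_S: "finite S" and S_nonempty: "S \<noteq> {}"
  using indep_pair by (auto simp: independence_pair_def)

lemma empty_trace_eq: "\<epsilon> = cls []"
  by (simp add: trace_monoid_def)

lemma traces_eq: "traces = cls ` lists S"
  by (auto simp: trace_monoid_def quotient_def trace_of_def)

lemma cls_in_traces [simp]: "w \<in> lists S \<Longrightarrow> cls w \<in> traces"
  unfolding traces_eq by (rule imageI)

lemma tracesE:
  assumes "u \<in> traces" obtains w where "w \<in> lists S" "u = cls w"
  using assms unfolding traces_eq by blast

lemma cls_eq_iff: "u \<in> lists S \<Longrightarrow> v \<in> lists S \<Longrightarrow> cls u = cls v \<longleftrightarrow> u \<simeq> v"
  using eq_equiv_class_iff[OF equiv_trace_rel, of u S v I]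
  by (simp add: trace_of_def trace_rel_def)

sublocale monoid_cancel M
proof -
  have "monoid M"
  proof (rule monoidI)
    show "\<epsilon> \<in> traces" by (simp add: empty_trace_eq)
  qed (auto simp: empty_trace_eq elim!: tracesE)
  then show "monoid_cancel M"
  proof (rule monoid.monoid_cancelI)
    fix u v w assume "u \<in> traces" "v \<in> traces" "w \<in> traces"
    then show "w \<odot> u = w \<odot> v \<Longrightarrow> u = v" "u \<odot> w = v \<odot> w \<Longrightarrow> u = v"
      by (elim tracesE;
          simp add: cls_eq_iff trace_eq_append_cancel_left trace_eq_append_cancel_right)+
  qed
qed

lemma cls_le_iff:
  assumes u: "u \<in> lists S" and v: "v \<in> lists S"
  shows "cls u \<unlhd> cls v \<longleftrightarrow> u \<preceq> v"
proof
  assume "cls u \<unlhd> cls v"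
  then obtain z where z: "z \<in> lists S" "cls v = cls u \<odot> cls z"
    by (auto simp: factor_def elim!: tracesE)
  then have "v \<simeq> u @ z" using cls_eq_iff[of v "u @ z"] u v by simp
  then show "u \<preceq> v" using word_le_iff_factor by blast
next
  assume "u \<preceq> v"
  then obtain z where z: "v \<simeq> u @ z" using word_le_imp_factor by blast
  then have "set z \<subseteq> set v" using set_mono_word_le trace_eq_imp_word_le trace_eq.sym by fastforce
  then have "z \<in> lists S" using v by (auto simp: in_lists_conv_set)
  then show "cls u \<unlhd> cls v"
    using cls_eq_iff[of v "u @ z"] z u v by (intro dividesI[of "cls z"]) auto
qed

lemma len_empty_trace [simp]: "len \<epsilon> = 0"
  by (simp add: empty_trace_eq)

lemma len_mult [simp]: "u \<in> traces \<Longrightarrow> v \<in> traces \<Longrightarrow> len (u \<odot> v) = len u + len v"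
  by (auto elim!: tracesE)

lemma len_eq_0_iff: "u \<in> traces \<Longrightarrow> len u = 0 \<longleftrightarrow> u = \<epsilon>"
  by (auto simp: empty_trace_eq elim!: tracesE)

lemma empty_trace_le [simp]: "u \<in> traces \<Longrightarrow> \<epsilon> \<unlhd> u"
  by (rule dividesI[of u]) auto

lemma le_mult [simp]: "u \<in> traces \<Longrightarrow> v \<in> traces \<Longrightarrow> u \<unlhd> u \<odot> v"
  by (rule dividesI[of v]) auto

lemma le_imp_len_le: "u \<unlhd> v \<Longrightarrow> u \<in> traces \<Longrightarrow> len u \<le> len v"
  by auto

lemma le_imp_eq: "u \<unlhd> v \<Longrightarrow> u \<in> traces \<Longrightarrow> len v \<le> len u \<Longrightarrow> u = v"
  using len_eq_0_iff by auto

lemma le_antisym: "u \<unlhd> v \<Longrightarrow> v \<unlhd> u \<Longrightarrow> u \<in> traces \<Longrightarrow> v \<in> traces \<Longrightarrow> u = v"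
  by (simp add: le_imp_eq le_imp_len_le)

lemma ex_lcm:
  assumes "u \<in> traces" "v \<in> traces" "t \<in> traces" "u \<unlhd> t" "v \<unlhd> t"
  shows "\<exists>w\<in>traces. w lcmof\<^bsub>M\<^esub> u v"
proof -
  obtain u' v' t' where words: "u' \<in> lists S" "u = cls u'" "v' \<in> lists S" "v = cls v'"
    "t' \<in> lists S" "t = cls t'" using assms(1-3) by (elim tracesE)
  then have "u' \<preceq> t'" "v' \<preceq> t'" using assms by (simp_all add: cls_le_iff)
  then obtain w where w: "word_lub u' v' w" using ex_word_lub by blast
  then have "w \<preceq> t'" using \<open>u' \<preceq> t'\<close> \<open>v' \<preceq> t'\<close> by (simp add: word_lub_def)
  then have "w \<in> lists S" using set_mono_word_le words(5) by (fastforce simp: in_lists_conv_set)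
  then have "cls w lcmof\<^bsub>M\<^esub> u v"
    using w words by (auto simp: islcm_def word_lub_def cls_le_iff elim!: tracesE)
  then show ?thesis using \<open>w \<in> lists S\<close> by (intro bexI) auto
qed

lemma finite_lcms: "finite {w \<in> traces. w lcmof\<^bsub>M\<^esub> u v}"
proof -
  have "{w \<in> traces. w lcmof\<^bsub>M\<^esub> u v} \<subseteq> {x}" if "x \<in> traces" "x lcmof\<^bsub>M\<^esub> u v" for x
    using that le_antisym unfolding islcm_def by blast
  then show ?thesis
    by (cases "{w \<in> traces. w lcmof\<^bsub>M\<^esub> u v} = {}") (auto intro: finite_subset)
qed

definition traces_of_len :: "nat \<Rightarrow> 'a list set set" where
  "traces_of_len n = {u \<in> traces. len u = n}"

lemma mem_traces_of_len [simp]: "u \<in> traces_of_len n \<longleftrightarrow> u \<in> traces \<and> len u = n"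
  by (simp add: traces_of_len_def)

lemma finite_traces_of_len: "finite (traces_of_len n)"
proof -
  have "traces_of_len n \<subseteq> cls ` {w. set w \<subseteq> S \<and> length w = n}"
    by (auto simp: lists_eq_set elim!: tracesE)
  then show ?thesis by (rule finite_surj[OF finite_lists_length_eq[OF finite_S]])
qed

lemma ex_trace_of_len: "\<exists>u\<in>traces. len u = n"
proof -
  obtain a where "a \<in> S" using S_nonempty by blast
  then show ?thesis by (intro bexI[of _ "cls (replicate n a)"]) (simp_all add: in_lists_conv_set)
qed

lemma countable_traces: "countable traces"
  unfolding traces_eq using finite_S by (intro countable_image countable_lists countable_finite)

lemma trace_split:
  assumes "u \<in> traces" "len u = m + n"
  obtains v w where "v \<in> traces_of_len m" "w \<in> traces_of_len n" "u = v \<odot> w"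
proof -
  obtain x where x: "x \<in> lists S" "u = cls x" using assms(1) by (elim tracesE)
  then have "take m x \<in> lists S" "drop m x \<in> lists S"
    by (auto simp: in_lists_conv_set dest: in_set_takeD in_set_dropD)
  then show ?thesis
    using x assms(2)
    by (intro that[of "cls (take m x)" "cls (drop m x)"]) auto
qed

lemma ex_mult_letter_le:
  assumes "u \<in> traces" "v \<in> traces" "u \<unlhd> v" "u \<noteq> v"
  shows "\<exists>a\<in>S. u \<odot> cls [a] \<unlhd> v"
proof -
  obtain t where t: "t \<in> lists S" "v = u \<odot> cls t" using assms(3) by (auto elim!: tracesE)
  then obtain a s where "t = a # s" using assms by (cases t) (auto simp: empty_trace_eq[symmetric])
  then have "a \<in> S" "v = u \<odot> cls [a] \<odot> cls s" using t assms(1) by (auto simp: m_assoc)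
  then show ?thesis using assms(1) \<open>t = a # s\<close> t(1) by (intro bexI[of _ a]) simp_all
qed

section \<open>Cliques and Moebius inversion\<close>

lemma cliques_eq: "cliques S I = cls ` {w \<in> lists S. clique_word w}"
  by (auto simp: cliques_def clique_word_iff_nth)

lemma cliqueE:
  assumes "c \<in> cliques S I" obtains w where "w \<in> lists S" "clique_word w" "c = cls w"
  using assms unfolding cliques_eq by blast

lemma cliques_subset: "cliques S I \<subseteq> traces"
  by (auto elim!: cliqueE)

definition min_letters :: "'a list set \<Rightarrow> 'a set" where
  "min_letters u = {a \<in> S. cls [a] \<unlhd> u}"

lemma finite_min_letters: "finite (min_letters u)"
  using finite_S by (simp add: min_letters_def)

lemma min_letters_cls: "w \<in> lists S \<Longrightarrow> min_letters (cls w) = {a \<in> S. [a] \<preceq> w}"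
  by (auto simp: min_letters_def cls_le_iff)

lemma min_letters_clique_word:
  "w \<in> lists S \<Longrightarrow> clique_word w \<Longrightarrow> min_letters (cls w) = set w"
  by (auto simp: in_lists_conv_set min_letters_cls letter_le_clique_word_iff)

lemma min_letters_mono: "u \<unlhd> v \<Longrightarrow> min_letters u \<subseteq> min_letters v"
  by (auto simp: min_letters_def intro: divides_trans)

lemma card_min_letters_clique: "c \<in> cliques S I \<Longrightarrow> card (min_letters c) = len c"
  by (auto simp: min_letters_clique_word clique_word_iff_set distinct_card elim!: cliqueE)

lemma clique_le_iff:
  assumes "c \<in> cliques S I" "t \<in> traces"
  shows "c \<unlhd> t \<longleftrightarrow> min_letters c \<subseteq> min_letters t"
proof
  assume sub: "min_letters c \<subseteq> min_letters t"
  obtain w x where words: "w \<in> lists S" "clique_word w" "c = cls w" "x \<in> lists S" "t = cls x"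
    using assms by (elim cliqueE tracesE)
  then have "[a] \<preceq> x" if "a \<in> set w" for a
    using sub that by (auto simp: min_letters_clique_word min_letters_cls)
  then have "w \<preceq> x" using words(2) clique_word_leI by blast
  then show "c \<unlhd> t" using words by (simp add: cls_le_iff)
qed (rule min_letters_mono)

lemma inj_on_min_letters: "inj_on min_letters (cliques S I)"
proof (rule inj_onI)
  fix c d assume cliques: "c \<in> cliques S I" "d \<in> cliques S I" "min_letters c = min_letters d"
  then have "c \<in> traces" "d \<in> traces" using cliques_subset by auto
  then show "c = d" using cliques by (intro le_antisym) (simp_all add: clique_le_iff)
qed

lemma finite_cliques: "finite (cliques S I)"
  by (rule inj_on_finite[OF inj_on_min_letters, of "Pow S"]) (auto simp: min_letters_def finite_S)

lemma ex_clique_with_min_letters: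
  assumes "B \<subseteq> min_letters t" "t \<in> traces"
  shows "\<exists>c\<in>cliques S I. min_letters c = B"
proof -
  obtain x where x: "x \<in> lists S" "t = cls x" using assms(2) by (elim tracesE)
  have B: "B \<subseteq> S" "\<And>a. a \<in> B \<Longrightarrow> [a] \<preceq> x" using assms(1) x by (auto simp: min_letters_cls)
  obtain w where w: "set w = B" "distinct w"
    using finite_distinct_list finite_subset[OF B(1) finite_S] by blast
  then have "clique_word w" unfolding clique_word_iff_set using B(2) letters_le_imp_indep by blast
  moreover have "w \<in> lists S" using w(1) B(1) by (auto simp: in_lists_conv_set)
  ultimately show ?thesis
    using w(1) by (intro bexI[of _ "cls w"]) (auto simp: min_letters_clique_word cliques_eq)
qed

lemma bij_betw_min_letters:
  assumes "t \<in> traces"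
  shows "bij_betw min_letters {c \<in> cliques S I. c \<unlhd> t} (Pow (min_letters t))"
  unfolding bij_betw_def
proof
  show "inj_on min_letters {c \<in> cliques S I. c \<unlhd> t}"
    by (rule inj_on_subset[OF inj_on_min_letters]) auto
  show "min_letters ` {c \<in> cliques S I. c \<unlhd> t} = Pow (min_letters t)"
  proof (intro equalityI subsetI)
    fix B assume "B \<in> Pow (min_letters t)"
    then obtain c where "c \<in> cliques S I" "min_letters c = B"
      using ex_clique_with_min_letters assms by blast
    then show "B \<in> min_letters ` {c \<in> cliques S I. c \<unlhd> t}"
      using \<open>B \<in> Pow (min_letters t)\<close> clique_le_iff[OF _ assms] by blast
  qed (use min_letters_mono in blast)
qed

lemma min_letters_eq_empty_iff:
  assumes "t \<in> traces"
  shows "min_letters t = {} \<longleftrightarrow> t = \<epsilon>"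
proof
  assume "min_letters t = {}"
  then show "t = \<epsilon>"
    using ex_mult_letter_le[OF one_closed assms] assms by (auto simp: min_letters_def)
next
  assume "t = \<epsilon>"
  then show "min_letters t = {}"
    using le_imp_len_le[of "cls [_]" \<epsilon>] by (fastforce simp: min_letters_def)
qed

lemma sum_cliques_le:
  assumes "t \<in> traces"
  shows "(\<Sum>c\<in>{c \<in> cliques S I. c \<unlhd> t}. (- 1) ^ len c) =
    (if t = \<epsilon> then 1 else 0 :: 'c :: comm_ring_1)"
proof -
  have "(\<Sum>c\<in>{c \<in> cliques S I. c \<unlhd> t}. (- 1) ^ len c) =
      (\<Sum>c\<in>{c \<in> cliques S I. c \<unlhd> t}. (- 1) ^ card (min_letters c) :: 'c)"
    by (intro sum.cong) (simp_all add: card_min_letters_clique)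
  also have "\<dots> = (\<Sum>B\<in>Pow (min_letters t). (- 1) ^ card B)"
    by (rule sum.reindex_bij_betw[OF bij_betw_min_letters[OF assms]])
  also have "\<dots> = (\<Prod>a\<in>min_letters t. 1 - 1)"
    by (subst prod_diff_conv_sum) (simp_all add: finite_min_letters)
  also have "\<dots> = (if t = \<epsilon> then 1 else 0)"
    by (simp add: power_0_left finite_min_letters min_letters_eq_empty_iff[OF assms])
  finally show ?thesis .
qed

section \<open>Synchronizing traces\<close>

definition synchronizing :: "'a list set \<Rightarrow> bool" where
  "synchronizing w \<longleftrightarrow> (\<forall>u\<in>traces. \<forall>v\<in>traces. \<forall>t\<in>traces.
    len u = len v \<longrightarrow> u \<odot> w \<unlhd> t \<longrightarrow> v \<odot> w \<unlhd> t \<longrightarrow> u = v)"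

lemma ex_synchronizing_trace:
  assumes "irreducible_pair S I"
  shows "\<exists>w\<in>traces. synchronizing w"
proof -
  obtain w where w: "w \<noteq> []" "S \<subseteq> set w" "set w \<subseteq> S"
    "successively (\<lambda>x y. (x, y) \<in> S \<times> S - I) w"
    using ex_covering_walk[OF finite_S subset_refl S_nonempty, of "S \<times> S - I"] assms
    by (auto simp: irreducible_pair_def)
  then have "w \<in> lists S" by (auto simp: in_lists_conv_set)
  have walk: "dependence_walk w" using w(4) by (rule successively_mono) auto
  have "synchronizing (cls w)"
    unfolding synchronizing_def
  proof (intro ballI impI)
    fix u v t assume uvt: "u \<in> traces" "v \<in> traces" "t \<in> traces" "len u = len v"
      "u \<odot> cls w \<unlhd> t" "v \<odot> cls w \<unlhd> t"
    obtain u' v' t' where words: "u' \<in> lists S" "u = cls u'" "v' \<in> lists S" "v = cls v'"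
      "t' \<in> lists S" "t = cls t'" using uvt(1-3) by (elim tracesE)
    have "u' @ w \<preceq> t'" "v' @ w \<preceq> t'"
      using uvt(5,6) words \<open>w \<in> lists S\<close> cls_le_iff[of "_ @ w" t'] by simp_all
    moreover have "set u' \<subseteq> set w" "set v' \<subseteq> set w"
      using words w(2) by (auto simp: in_lists_conv_set)
    ultimately have "u' \<simeq> v'" using append_walk_inj[OF walk] uvt(4) words by simp
    then show "u = v" using words by (simp add: cls_eq_iff)
  qed
  then show ?thesis using \<open>w \<in> lists S\<close> by (intro bexI) auto
qed

section \<open>The growth series\<close>

definition growth :: "'c :: {real_normed_field, banach} \<Rightarrow> 'c" where
  "growth z = (\<Sum>\<^sub>\<infinity>u\<in>traces. z ^ len u)"

definition trace_count :: "nat \<Rightarrow> real" where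
  "trace_count n = card (traces_of_len n)"

text \<open>The radius is at most \<open>1\<close>, as there are traces of every length, so the conversion to
  a real number loses nothing.\<close>

definition growth_radius :: real where
  "growth_radius = real_of_ereal (conv_radius trace_count)"

lemma one_le_trace_count: "1 \<le> trace_count n"
proof -
  have "traces_of_len n \<noteq> {}" using ex_trace_of_len[of n] by auto
  then have "card (traces_of_len n) \<noteq> 0" using finite_traces_of_len card_0_eq by blast
  then show ?thesis by (simp add: trace_count_def)
qed

lemma trace_count_add: "trace_count (m + n) \<le> trace_count m * trace_count n"
proof -
  have "traces_of_len (m + n) \<subseteq> (\<lambda>(u, v). u \<odot> v) ` (traces_of_len m \<times> traces_of_len n)"
    by (fastforce elim: trace_split)
  then have "card (traces_of_len (m + n)) \<le> card (traces_of_len m \<times> traces_of_len n)"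
    by (intro surj_card_le finite_cartesian_product finite_traces_of_len)
  then show ?thesis
    by (simp add: trace_count_def card_cartesian_product flip: of_nat_mult)
qed

lemma less_conv_radius_trace_count:
  "0 \<le> r \<Longrightarrow> trace_count n * r ^ n < 1 \<Longrightarrow> ereal r < conv_radius trace_count"
  by (rule submultiplicative_less_conv_radius[OF _ trace_count_add]) (simp_all add: trace_count_def)

lemma conv_radius_trace_count: "conv_radius trace_count = ereal growth_radius"
  and growth_radius_pos: "0 < growth_radius"
proof -
  have "\<not> trace_count \<longlonglongrightarrow> 0"
    using LIMSEQ_le_const[of trace_count 0 1] one_le_trace_count by auto
  then have "\<not> summable (\<lambda>n. trace_count n * 1 ^ n)" using summable_LIMSEQ_zero by auto
  then have "conv_radius trace_count \<le> 1"
    using conv_radius_leI'[of trace_count 1] by (simp add: one_ereal_def)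
  moreover have "0 < conv_radius trace_count"
    using less_conv_radius_trace_count[of 0 1] by (simp add: zero_ereal_def)
  ultimately show "conv_radius trace_count = ereal growth_radius" "0 < growth_radius"
    unfolding growth_radius_def by (cases "conv_radius trace_count"; simp)+
qed

lemma one_le_trace_count_mult_growth_radius: "1 \<le> trace_count n * growth_radius ^ n"
  using less_conv_radius_trace_count[of growth_radius n] growth_radius_pos
  by (fastforce simp: conv_radius_trace_count not_le)

lemma sum_traces_shorter:
  "(\<Sum>u\<in>(\<Union>k<n. traces_of_len k). g (len u)) = (\<Sum>k<n. trace_count k * g k)"
proof -
  have "(\<Sum>u\<in>(\<Union>k<n. traces_of_len k). g (len u)) = (\<Sum>k<n. \<Sum>u\<in>traces_of_len k. g (len u))"
    by (intro sum.UNION_disjoint) (auto simp: finite_traces_of_len)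
  also have "\<dots> = (\<Sum>k<n. \<Sum>u\<in>traces_of_len k. g k)"
    by (intro sum.cong) auto
  finally show ?thesis by (simp add: trace_count_def)
qed

lemma abs_summable_growth:
  fixes z :: "'c :: real_normed_field"
  assumes "norm z < growth_radius"
  shows "(\<lambda>u. z ^ len u) abs_summable_on traces"
proof (rule nonneg_bdd_above_summable_on)
  have summable: "summable (\<lambda>n. trace_count n * norm z ^ n)"
    using assms by (intro summable_in_conv_radius) (simp add: conv_radius_trace_count)
  show "bdd_above (sum (\<lambda>u. norm (z ^ len u)) ` {F. F \<subseteq> traces \<and> finite F})"
  proof (rule bdd_aboveI2)
    fix F assume "F \<in> {F. F \<subseteq> traces \<and> finite F}"
    then have F: "F \<subseteq> traces" "finite F" by auto
    obtain n where "\<forall>u\<in>F. len u < n"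
      using finite_nat_set_iff_bounded[of "len ` F"] F(2) by auto
    then have "(\<Sum>u\<in>F. norm (z ^ len u)) \<le> (\<Sum>u\<in>(\<Union>k<n. traces_of_len k). norm (z ^ len u))"
      using F(1) by (intro sum_mono2) (auto simp: finite_traces_of_len)
    also have "\<dots> = (\<Sum>k<n. trace_count k * norm z ^ k)"
      using sum_traces_shorter[of "\<lambda>k. norm z ^ k" n] by (simp add: norm_power)
    also have "\<dots> \<le> (\<Sum>k. trace_count k * norm z ^ k)"
      using summable by (intro sum_le_suminf) (auto simp: trace_count_def)
    finally show "(\<Sum>u\<in>F. norm (z ^ len u)) \<le> (\<Sum>k. trace_count k * norm z ^ k)" .
  qed
qed simp

lemma summable_growth:
  fixes z :: "'c :: {real_normed_field, banach}"
  shows "norm z < growth_radius \<Longrightarrow> (\<lambda>u. z ^ len u) summable_on traces"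
  by (rule abs_summable_summable[OF abs_summable_growth])

lemma has_sum_growth: "norm z < growth_radius \<Longrightarrow> ((\<lambda>u. z ^ len u) has_sum growth z) traces"
  unfolding growth_def by (rule has_sum_infsum[OF summable_growth])

lemma has_sum_growth_multiples:
  assumes "norm z < growth_radius" and u: "u \<in> traces"
  shows "((\<lambda>v. z ^ len v) has_sum (z ^ len u * growth z)) {v \<in> traces. u \<unlhd> v}"
proof -
  have "{v \<in> traces. u \<unlhd> v} = (\<odot>) u ` traces" using u by (auto simp: factor_def)
  moreover have "inj_on ((\<odot>) u) traces" using l_cancel u by (intro inj_onI) blast
  moreover have "((\<lambda>v. z ^ len u * z ^ len v) has_sum (z ^ len u * growth z)) traces"
    by (intro has_sum_cmult_right has_sum_growth assms(1))
  then have "((\<lambda>v. z ^ len (u \<odot> v)) has_sum (z ^ len u * growth z)) traces"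
    by (rule has_sum_cong[THEN iffD1, rotated]) (simp add: u power_add)
  ultimately show ?thesis by (simp add: has_sum_reindex o_def)
qed

lemma poly_moebius_poly:
  "poly (moebius_poly S I) z = (\<Sum>c\<in>cliques S I. (- 1) ^ len c * z ^ len c)"
  by (simp add: moebius_poly_def poly_sum poly_monom)

lemma growth_mult_moebius:
  assumes "norm z < growth_radius"
  shows "poly (moebius_poly S I) z * growth z = 1"
proof -
  let ?f = "\<lambda>c v. (- 1) ^ len c * (if c \<unlhd> v then z ^ len v else 0)"
  have "((\<lambda>v. \<Sum>c\<in>cliques S I. ?f c v) has_sum (poly (moebius_poly S I) z * growth z)) traces"
    unfolding poly_moebius_poly sum_distrib_right mult.assoc
  proof (intro has_sum_sum has_sum_cmult_right)
    fix c assume "c \<in> cliques S I"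
    then have "c \<in> traces" using cliques_subset by blast
    from has_sum_growth_multiples[OF assms this]
    show "((\<lambda>v. if c \<unlhd> v then z ^ len v else 0) has_sum (z ^ len c * growth z)) traces"
      by (rule has_sum_cong_neutral[THEN iffD1, rotated -1]) auto
  qed
  moreover have "(\<Sum>c\<in>cliques S I. ?f c v) = (if v = \<epsilon> then 1 else 0)" if "v \<in> traces" for v
  proof -
    have "(\<Sum>c\<in>cliques S I. ?f c v) =
        (\<Sum>c\<in>cliques S I. if c \<unlhd> v then (- 1) ^ len c * z ^ len v else 0)"
      by (intro sum.cong) auto
    also have "\<dots> = (\<Sum>c\<in>{c \<in> cliques S I. c \<unlhd> v}. (- 1) ^ len c) * z ^ len v"
      unfolding sum_distrib_right by (simp add: sum.inter_filter[OF finite_cliques])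
    finally show ?thesis by (simp add: sum_cliques_le[OF that])
  qed
  ultimately have "((\<lambda>v. if v = \<epsilon> then 1 else 0) has_sum
      (poly (moebius_poly S I) z * growth z)) traces"
    by (simp cong: has_sum_cong)
  moreover have "((\<lambda>v. if v = \<epsilon> then 1 else 0 :: complex) has_sum 1) traces"
    by (rule has_sum_finite_neutralI[of "{\<epsilon>}"]) auto
  ultimately show ?thesis by (rule has_sum_unique)
qed

lemma growth_ge_sum_trace_count:
  assumes "0 \<le> x" "x < growth_radius"
  shows "(\<Sum>k<n. trace_count k * x ^ k) \<le> growth x"
proof -
  have "(\<Sum>u\<in>(\<Union>k<n. traces_of_len k). x ^ len u) \<le> growth x"
    unfolding growth_def using assms
    by (intro finite_sum_le_infsum summable_growth) (auto simp: finite_traces_of_len)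
  then show ?thesis by (simp add: sum_traces_shorter)
qed

lemma growth_pos: "0 \<le> x \<Longrightarrow> x < growth_radius \<Longrightarrow> 0 < growth x" for x :: real
  using growth_ge_sum_trace_count[of x 1] one_le_trace_count[of 0] by simp

lemma eventually_at_left_growth_radius:
  "eventually (\<lambda>x. 0 \<le> x \<and> x < growth_radius) (at_left growth_radius)"
  using eventually_at_left_real[OF growth_radius_pos] by (rule eventually_mono) auto

lemma filterlim_growth_at_top: "filterlim growth at_top (at_left growth_radius)"
  unfolding filterlim_at_top_dense
proof
  fix C :: real
  obtain n where "C < real n" using reals_Archimedean2 by blast
  also have "real n \<le> (\<Sum>k<n. trace_count k * growth_radius ^ k)"
    using sum_mono[of "{..<n}" "\<lambda>_. 1" "\<lambda>k. trace_count k * growth_radius ^ k"]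
      one_le_trace_count_mult_growth_radius by simp
  finally have "C < (\<Sum>k<n. trace_count k * growth_radius ^ k)" .
  moreover have "((\<lambda>x. \<Sum>k<n. trace_count k * x ^ k) \<longlongrightarrow>
      (\<Sum>k<n. trace_count k * growth_radius ^ k)) (at_left growth_radius)"
    by (intro tendsto_intros)
  ultimately have "eventually (\<lambda>x. C < (\<Sum>k<n. trace_count k * x ^ k)) (at_left growth_radius)"
    by (intro order_tendstoD(1))
  then show "eventually (\<lambda>x. C < growth x) (at_left growth_radius)"
    using eventually_at_left_growth_radius
    by eventually_elim (use growth_ge_sum_trace_count less_le_trans in blast)
qed

lemma growth_of_real:
  assumes "\<bar>x\<bar> < growth_radius"
  shows "growth (complex_of_real x) = of_real (growth x)"
proof (rule has_sum_unique[OF has_sum_growth])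
  show "((\<lambda>u. complex_of_real x ^ len u) has_sum of_real (growth x)) traces"
    using has_sum_of_real[OF has_sum_growth[of x]] assms by simp
qed (use assms in simp)

lemma moebius_poly_growth_radius: "poly (moebius_poly S I) (complex_of_real growth_radius) = 0"
proof (rule tendsto_unique)
  show "((\<lambda>x. poly (moebius_poly S I) (of_real x)) \<longlongrightarrow>
      poly (moebius_poly S I) (of_real growth_radius)) (at_left growth_radius)"
    by (intro tendsto_intros)
  have "((\<lambda>x. inverse (growth x)) \<longlongrightarrow> 0) (at_left growth_radius)"
    by (rule tendsto_inverse_0_at_top[OF filterlim_growth_at_top])
  then have "((\<lambda>x. complex_of_real (inverse (growth x))) \<longlongrightarrow> of_real 0) (at_left growth_radius)"
    by (rule tendsto_of_real)
  moreover have "eventually (\<lambda>x. of_real (inverse (growth x)) = poly (moebius_poly S I) (of_real x))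
      (at_left growth_radius)"
    using eventually_at_left_growth_radius
  proof eventually_elim
    case (elim x)
    then show ?case
      using growth_mult_moebius[of "of_real x"] growth_pos[of x]
      by (simp add: growth_of_real field_simps)
  qed
  ultimately show "((\<lambda>x. poly (moebius_poly S I) (of_real x)) \<longlongrightarrow> 0) (at_left growth_radius)"
    by (simp add: Lim_transform_eventually)
qed simp

lemma unique_smallest_root_eq_growth_radius:
  assumes "unique_smallest_root (moebius_poly S I) p0"
  shows "p0 = of_real growth_radius"
proof (rule ccontr)
  assume "p0 \<noteq> of_real growth_radius"
  then have "cmod p0 < growth_radius" "poly (moebius_poly S I) p0 = 0"
    using assms moebius_poly_growth_radius growth_radius_pos
    by (auto simp: unique_smallest_root_def)
  then show False using growth_mult_moebius[of p0] by simp
qed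

section \<open>Boltzmann distributions\<close>

definition boltzmann :: "real \<Rightarrow> 'a list set set \<Rightarrow> real" where
  "boltzmann s A = (\<Sum>\<^sub>\<infinity>v\<in>traces \<inter> A. s ^ len v) / growth s"

context
  fixes s :: real
  assumes s: "0 \<le> s" "s < growth_radius"
begin

lemma prob_charge_boltzmann: "prob_charge (boltzmann s)"
  unfolding prob_charge_def
proof (intro conjI allI impI)
  fix A
  show "0 \<le> boltzmann s A"
    using s growth_pos[OF s]
    by (auto simp: boltzmann_def intro!: divide_nonneg_nonneg infsum_nonneg)
next
  fix A B :: "'a list set set" assume "A \<inter> B = {}"
  then have "traces \<inter> A \<inter> (traces \<inter> B) = {}" by blast
  moreover have "(\<lambda>v. s ^ len v) summable_on traces \<inter> C" for C
    by (rule summable_on_subset_banach[OF summable_growth]) (use s in auto)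
  ultimately show "boltzmann s (A \<union> B) = boltzmann s A + boltzmann s B"
    unfolding boltzmann_def Int_Un_distrib by (simp add: infsum_Un_disjoint add_divide_distrib)
next
  show "boltzmann s UNIV = 1"
    using growth_pos[OF s] by (simp add: boltzmann_def growth_def[symmetric])
qed

lemma boltzmann_traces: "boltzmann s traces = 1"
  using growth_pos[OF s] by (simp add: boltzmann_def growth_def[symmetric])

lemma boltzmann_multiples:
  assumes "u \<in> traces"
  shows "boltzmann s {v. u \<unlhd> v} = s ^ len u"
proof -
  have "traces \<inter> {v. u \<unlhd> v} = {v \<in> traces. u \<unlhd> v}" by auto
  then show ?thesis
    using infsumI[OF has_sum_growth_multiples[of s u]] s growth_pos[OF s] assms
    by (simp add: boltzmann_def)
qed

lemma boltzmann_singleton: "u \<in> traces \<Longrightarrow> boltzmann s {u} = s ^ len u / growth s"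
  by (simp add: boltzmann_def)

end

lemma ex_limit_of_boltzmann:
  obtains \<nu> where "prob_charge \<nu>" "\<nu> traces = 1"
    "\<And>u. u \<in> traces \<Longrightarrow> \<nu> {v. u \<unlhd> v} = growth_radius ^ len u"
    "\<And>u. u \<in> traces \<Longrightarrow> \<nu> {u} = 0"
proof -
  let ?F = "at_left growth_radius"
  note within_radius = eventually_at_left_growth_radius
  have "eventually (\<lambda>s. prob_charge (boltzmann s)) ?F"
    using within_radius by eventually_elim (simp add: prob_charge_boltzmann)
  then obtain \<nu> where "prob_charge \<nu>"
    and lim: "\<And>A L. ((\<lambda>s. boltzmann s A) \<longlongrightarrow> L) ?F \<Longrightarrow> \<nu> A = L"
    using prob_charge_cluster_point[OF trivial_limit_at_left_real] by blast
  show thesis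
  proof (rule that[OF \<open>prob_charge \<nu>\<close>]; rule lim)
    show "((\<lambda>s. boltzmann s traces) \<longlongrightarrow> 1) ?F"
      using within_radius
      by (intro tendsto_eventually) (auto elim: eventually_mono simp: boltzmann_traces)
  next
    fix u assume u: "u \<in> traces"
    have "((\<lambda>s. s ^ len u) \<longlongrightarrow> growth_radius ^ len u) ?F" by (intro tendsto_intros)
    then show "((\<lambda>s. boltzmann s {v. u \<unlhd> v}) \<longlongrightarrow> growth_radius ^ len u) ?F"
      by (rule Lim_transform_eventually)
        (use within_radius in \<open>auto elim: eventually_mono simp: boltzmann_multiples u\<close>)
  next
    fix u assume u: "u \<in> traces"
    have "((\<lambda>s. s ^ len u) \<longlongrightarrow> growth_radius ^ len u) ?F" by (intro tendsto_intros)
    then have "((\<lambda>s. s ^ len u * inverse (growth s)) \<longlongrightarrow> growth_radius ^ len u * 0) ?F"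
      by (intro tendsto_mult tendsto_inverse_0_at_top filterlim_growth_at_top)
    then have "((\<lambda>s. s ^ len u * inverse (growth s)) \<longlongrightarrow> 0) ?F" by simp
    then show "((\<lambda>s. boltzmann s {u}) \<longlongrightarrow> 0) ?F"
      by (rule Lim_transform_eventually)
        (use within_radius in \<open>auto elim: eventually_mono simp: boltzmann_singleton u divide_inverse\<close>)
  qed
qed

section \<open>Boundary points as ideals of traces\<close>

text \<open>Each of the conditions on \<open>x\<close> involves only finitely many of its values, so that it defines a
  clopen set in the product topology.\<close>

definition infinite_ideal :: "('a list set \<Rightarrow> bool) \<Rightarrow> bool" where
  "infinite_ideal x \<longleftrightarrow> x \<epsilon> \<and>
    (\<forall>u\<in>traces. \<forall>v\<in>traces. u \<unlhd> v \<and> x v \<longrightarrow> x u) \<and>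
    (\<forall>u\<in>traces. \<forall>v\<in>traces. x u \<and> x v \<longrightarrow> (\<exists>w\<in>traces. w lcmof\<^bsub>M\<^esub> u v \<and> x w)) \<and>
    (\<forall>u\<in>traces. x u \<longrightarrow> (\<exists>a\<in>S. x (u \<odot> cls [a])))"

lemma infinite_ideal_empty_trace: "infinite_ideal x \<Longrightarrow> x \<epsilon>"
  by (simp add: infinite_ideal_def)

lemma infinite_ideal_downward:
  "infinite_ideal x \<Longrightarrow> u \<in> traces \<Longrightarrow> v \<in> traces \<Longrightarrow> u \<unlhd> v \<Longrightarrow> x v \<Longrightarrow> x u"
  unfolding infinite_ideal_def by blast

lemma infinite_ideal_lcm:
  assumes "infinite_ideal x" "u \<in> traces" "v \<in> traces" "x u" "x v"
  obtains w where "w \<in> traces" "w lcmof\<^bsub>M\<^esub> u v" "x w"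
  using assms unfolding infinite_ideal_def by meson

lemma infinite_ideal_directed:
  assumes "infinite_ideal x" "u \<in> traces" "v \<in> traces" "x u" "x v"
  shows "\<exists>w\<in>traces. x w \<and> u \<unlhd> w \<and> v \<unlhd> w"
  using infinite_ideal_lcm[OF assms] by (metis islcm_def)

lemma infinite_ideal_finite_upper_bound:
  assumes x: "infinite_ideal x" and "finite F" "F \<subseteq> traces" "\<And>u. u \<in> F \<Longrightarrow> x u"
  shows "\<exists>w\<in>traces. x w \<and> (\<forall>u\<in>F. u \<unlhd> w)"
  using assms(2-)
proof (induction rule: finite_induct)
  case empty
  then show ?case using infinite_ideal_empty_trace[OF x] by (intro bexI[of _ \<epsilon>]) auto
next
  case (insert u F)
  then obtain v where v: "v \<in> traces" "x v" "\<forall>u\<in>F. u \<unlhd> v" by auto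
  then obtain w where w: "w \<in> traces" "x w" "u \<unlhd> w" "v \<unlhd> w"
    using infinite_ideal_directed[OF x, of u v] insert.prems by auto
  then have "\<forall>u\<in>F. u \<unlhd> w" using v(3) divides_trans insert.prems by blast
  then show ?case using w by auto
qed

lemma infinite_ideal_ex_len:
  assumes "infinite_ideal x"
  shows "\<exists>u\<in>traces. x u \<and> len u = n"
proof (induction n)
  case 0
  show ?case using infinite_ideal_empty_trace[OF assms] by (intro bexI[of _ \<epsilon>]) auto
next
  case (Suc n)
  then obtain u where u: "u \<in> traces" "x u" "len u = n" by blast
  then obtain a where "a \<in> S" "x (u \<odot> cls [a])"
    using assms unfolding infinite_ideal_def by blast
  then show ?case using u by (intro bexI[of _ "u \<odot> cls [a]"]) auto
qed

lemma trace_seqs_closed: "s \<in> trace_seqs S I \<Longrightarrow> s k \<in> traces"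
  and trace_seqs_mono: "s \<in> trace_seqs S I \<Longrightarrow> j \<le> k \<Longrightarrow> s j \<unlhd> s k"
  by (simp_all add: trace_seqs_def)

lemma seq_rel_refl: "s \<in> trace_seqs S I \<Longrightarrow> (s, s) \<in> seq_rel S I"
  by (auto simp: seq_rel_def seq_le_def trace_seqs_closed intro!: exI divides_refl)

lemma seq_le_trans:
  assumes "s \<in> trace_seqs S I" "seq_le S I s t" "seq_le S I t r"
  shows "seq_le S I s r"
  unfolding seq_le_def
proof
  fix k
  obtain j where j: "s k \<unlhd> t j" using assms(2) unfolding seq_le_def by blast
  obtain l where l: "t j \<unlhd> r l" using assms(3) unfolding seq_le_def by blast
  show "\<exists>k'. s k \<unlhd> r k'" using divides_trans[OF j l trace_seqs_closed[OF assms(1)]] ..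
qed

lemma equiv_seq_rel: "equiv (trace_seqs S I) (seq_rel S I)"
proof (rule equivI)
  show "seq_rel S I \<subseteq> trace_seqs S I \<times> trace_seqs S I" by (auto simp: seq_rel_def)
  show "refl_on (trace_seqs S I) (seq_rel S I)" by (simp add: refl_on_def seq_rel_refl)
  show "sym (seq_rel S I)" by (auto simp: sym_def seq_rel_def)
  show "trans (seq_rel S I)" unfolding trans_def seq_rel_def using seq_le_trans by blast
qed

lemma gen_le_embed_iff:
  assumes s: "s \<in> trace_seqs S I" and u: "u \<in> traces"
  shows "gen_le S I (embed S I u) (seq_rel S I `` {s}) \<longleftrightarrow> (\<exists>k. u \<unlhd> s k)"
proof -
  have const: "(\<lambda>_. u) \<in> trace_seqs S I" using u by (simp add: trace_seqs_def)
  have "gen_le S I (embed S I u) (seq_rel S I `` {s}) \<longleftrightarrow> seq_le S I (\<lambda>_. u) s"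
  proof
    assume "gen_le S I (embed S I u) (seq_rel S I `` {s})"
    then obtain s' t where "seq_le S I (\<lambda>_. u) s'" "seq_le S I s' t" "seq_le S I t s"
      by (auto simp: gen_le_def embed_def seq_rel_def)
    then show "seq_le S I (\<lambda>_. u) s" using seq_le_trans[OF const] by blast
  next
    assume "seq_le S I (\<lambda>_. u) s"
    then show "gen_le S I (embed S I u) (seq_rel S I `` {s})"
      using seq_rel_refl[OF const] seq_rel_refl[OF s] by (auto simp: gen_le_def embed_def)
  qed
  then show ?thesis by (simp add: seq_le_def)
qed

lemma bounded_trace_seq_eq_embed:
  assumes s: "s \<in> trace_seqs S I" and bound: "\<And>k. len (s k) < n"
  shows "\<exists>u\<in>traces. seq_rel S I `` {s} = embed S I u"
proof -
  obtain m where m: "\<And>k. len (s k) \<le> len (s m)"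
    using ex_has_greatest_nat[of "\<lambda>_. True" 0 "\<lambda>k. len (s k)" n] bound by auto
  have "s k \<unlhd> s m" for k
  proof (cases "k \<le> m")
    case False
    then have "s m \<unlhd> s k" using trace_seqs_mono[OF s] by simp
    then have "s m = s k" using le_imp_eq m trace_seqs_closed[OF s] by blast
    then show ?thesis using trace_seqs_closed[OF s] by simp
  qed (use trace_seqs_mono[OF s] in simp)
  then have "(\<lambda>_. s m, s) \<in> seq_rel S I"
    using s trace_seqs_closed[OF s]
    by (auto simp: seq_rel_def seq_le_def trace_seqs_def intro!: exI[of _ m])
  then have "embed S I (s m) = seq_rel S I `` {s}"
    unfolding embed_def by (rule equiv_class_eq[OF equiv_seq_rel])
  then show ?thesis using trace_seqs_closed[OF s] by auto
qed

lemma boundaryE: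
  assumes "\<xi> \<in> boundary S I"
  obtains s where "s \<in> trace_seqs S I" "\<And>u. u \<in> traces \<Longrightarrow> \<xi> \<in> up S I u \<longleftrightarrow> (\<exists>k. u \<unlhd> s k)"
    "\<And>n. \<exists>k. n \<le> len (s k)"
proof -
  obtain s where s: "s \<in> trace_seqs S I" "\<xi> = seq_rel S I `` {s}"
    using assms by (auto simp: boundary_def gen_traces_def quotient_def)
  have "\<exists>k. n \<le> len (s k)" for n
    using bounded_trace_seq_eq_embed[OF s(1), of n] assms s(2)
    by (auto simp: boundary_def not_le[symmetric])
  moreover have "\<xi> \<in> up S I u \<longleftrightarrow> (\<exists>k. u \<unlhd> s k)" if "u \<in> traces" for u
    using gen_le_embed_iff[OF s(1) that] assms s(2) by (simp add: up_def)
  ultimately show thesis using that s(1) by blast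
qed

lemma infinite_ideal_below_boundary:
  assumes "\<xi> \<in> boundary S I"
  shows "infinite_ideal (\<lambda>u. \<xi> \<in> up S I u)"
proof -
  obtain s where s: "s \<in> trace_seqs S I"
    and up: "\<And>u. u \<in> traces \<Longrightarrow> \<xi> \<in> up S I u \<longleftrightarrow> (\<exists>k. u \<unlhd> s k)"
    and unbounded: "\<And>n. \<exists>k. n \<le> len (s k)"
    using boundaryE[OF assms] by blast
  note s_closed = trace_seqs_closed[OF s]
  have le_s: "u \<unlhd> s k" if "u \<unlhd> s j" "j \<le> k" "u \<in> traces" for u j k
    using divides_trans[OF that(1) trace_seqs_mono[OF s that(2)] that(3)] .
  show ?thesis
    unfolding infinite_ideal_def
  proof (intro conjI ballI impI; (elim conjE)?)
    show "\<xi> \<in> up S I \<epsilon>" using s_closed by (simp add: up)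
  next
    fix u v assume uv: "u \<in> traces" "v \<in> traces" "u \<unlhd> v" "\<xi> \<in> up S I v"
    then obtain k where "v \<unlhd> s k" by (auto simp: up)
    then have "u \<unlhd> s k" using divides_trans uv(1,3) by blast
    then show "\<xi> \<in> up S I u" using up uv(1) by blast
  next
    fix u v assume uv: "u \<in> traces" "v \<in> traces" "\<xi> \<in> up S I u" "\<xi> \<in> up S I v"
    then obtain i j where "u \<unlhd> s i" "v \<unlhd> s j" by (auto simp: up)
    then have bound: "u \<unlhd> s (max i j)" "v \<unlhd> s (max i j)" using le_s uv by auto
    then obtain w where w: "w \<in> traces" "w lcmof\<^bsub>M\<^esub> u v" using ex_lcm uv s_closed by blast
    then have "w \<unlhd> s (max i j)" using bound s_closed by (auto simp: islcm_def)
    then show "\<exists>w\<in>traces. w lcmof\<^bsub>M\<^esub> u v \<and> \<xi> \<in> up S I w" using w up by blast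
  next
    fix u assume u: "u \<in> traces" "\<xi> \<in> up S I u"
    obtain i where i: "u \<unlhd> s i" using u by (auto simp: up)
    obtain j where j: "Suc (len u) \<le> len (s j)" using unbounded by blast
    have "len (s j) \<le> len (s (max i j))"
      using trace_seqs_mono[OF s] s_closed by (intro le_imp_len_le) auto
    then have "u \<noteq> s (max i j)" using j by auto
    then obtain a where "a \<in> S" "u \<odot> cls [a] \<unlhd> s (max i j)"
      using ex_mult_letter_le[of u "s (max i j)"] le_s[OF i] u(1) s_closed by auto
    then show "\<exists>a\<in>S. \<xi> \<in> up S I (u \<odot> cls [a])" using up u(1) by auto
  qed
qed

lemma ex_boundary_of_infinite_ideal:
  assumes x: "infinite_ideal x"
  shows "\<exists>\<xi>\<in>boundary S I. \<forall>u\<in>traces. \<xi> \<in> up S I u \<longleftrightarrow> x u"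
proof -
  let ?J = "{u \<in> traces. x u}"
  have "countable ?J" using countable_traces by (rule countable_subset[rotated]) auto
  moreover have "\<epsilon> \<in> ?J" using infinite_ideal_empty_trace[OF x] by simp
  then have "?J \<noteq> {}" by blast
  ultimately have "\<exists>s :: nat \<Rightarrow> 'a list set. (\<forall>k. s k \<in> ?J) \<and> (\<forall>j k. j \<le> k \<longrightarrow> s j \<unlhd> s k) \<and>
      (\<forall>u\<in>?J. \<exists>k. u \<unlhd> s k)"
  proof (rule countable_directed_cofinal_chain[where R = "\<lambda>u v. u \<unlhd> v"])
    show "\<exists>w\<in>?J. u \<unlhd> w \<and> v \<unlhd> w" if "u \<in> ?J" "v \<in> ?J" for u v
      using infinite_ideal_directed[OF x, of u v] that by auto
  qed (auto intro: divides_trans)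
  then obtain s :: "nat \<Rightarrow> 'a list set" where s: "\<And>k. s k \<in> ?J" "\<And>j k. j \<le> k \<Longrightarrow> s j \<unlhd> s k"
    and cofinal: "\<And>u. u \<in> ?J \<Longrightarrow> \<exists>k. u \<unlhd> s k" by blast
  have s_seq: "s \<in> trace_seqs S I" using s by (simp add: trace_seqs_def)
  define \<xi> where "\<xi> = seq_rel S I `` {s}"
  have le_\<xi>: "gen_le S I (embed S I u) \<xi> \<longleftrightarrow> x u" if u: "u \<in> traces" for u
    unfolding \<xi>_def gen_le_embed_iff[OF s_seq u]
    using s(1) u cofinal[of u] infinite_ideal_downward[OF x u] by blast
  have "\<xi> \<noteq> embed S I v" for v
  proof
    assume "\<xi> = embed S I v"
    then have "(\<lambda>_. v, s) \<in> seq_rel S I"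
      using seq_rel_refl[OF s_seq] by (auto simp: \<xi>_def embed_def)
    then have "s k \<unlhd> v" for k by (auto simp: seq_rel_def seq_le_def)
    moreover obtain u where u: "u \<in> traces" "x u" "len u = Suc (len v)"
      using infinite_ideal_ex_len[OF x] by blast
    moreover obtain k where "u \<unlhd> s k" using cofinal u by blast
    ultimately have "u \<unlhd> v" using divides_trans by blast
    then show False using le_imp_len_le[of u v] u by simp
  qed
  moreover have "\<xi> \<in> gen_traces S I" using s_seq by (simp add: \<xi>_def gen_traces_def quotientI)
  ultimately have "\<xi> \<in> boundary S I" by (auto simp: boundary_def)
  then show ?thesis using le_\<xi> by (auto simp: up_def)
qed

lemma up_subset_boundary: "up S I u \<subseteq> boundary S I"
  by (auto simp: up_def)

lemma infinite_ideal_below_up: "\<xi> \<in> up S I u \<Longrightarrow> infinite_ideal (\<lambda>u. \<xi> \<in> up S I u)"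
  using infinite_ideal_below_boundary up_subset_boundary by blast

lemma up_empty_trace: "up S I \<epsilon> = boundary S I"
  using infinite_ideal_below_boundary infinite_ideal_empty_trace up_subset_boundary by blast

lemma up_antimono: "u \<in> traces \<Longrightarrow> v \<in> traces \<Longrightarrow> u \<unlhd> v \<Longrightarrow> up S I v \<subseteq> up S I u"
  using infinite_ideal_downward[OF infinite_ideal_below_up] by blast

lemma up_Int:
  assumes "u \<in> traces" "v \<in> traces"
  shows "up S I u \<inter> up S I v \<in> insert {} (up S I ` traces)"
proof (cases "up S I u \<inter> up S I v = {}")
  case False
  then obtain \<xi> where "\<xi> \<in> up S I u" "\<xi> \<in> up S I v" by blast
  then obtain w where w: "w \<in> traces" "w lcmof\<^bsub>M\<^esub> u v"
    using infinite_ideal_lcm[OF infinite_ideal_below_up] assms by metis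
  have "up S I u \<inter> up S I v \<subseteq> up S I w"
  proof
    fix \<eta> assume \<eta>: "\<eta> \<in> up S I u \<inter> up S I v"
    then obtain t where t: "t \<in> traces" "\<eta> \<in> up S I t" "u \<unlhd> t" "v \<unlhd> t"
      using infinite_ideal_directed[OF infinite_ideal_below_up, of \<eta> u u v] assms by auto
    then have "w \<unlhd> t" using w(2) by (simp add: islcm_def)
    then show "\<eta> \<in> up S I w" using up_antimono w(1) t by blast
  qed
  moreover have "up S I w \<subseteq> up S I u \<inter> up S I v"
    using w up_antimono assms by (simp add: islcm_def)
  ultimately show ?thesis using w(1) by blast
qed simp

lemma sum_cliques_indicator:
  assumes u: "u \<in> traces"
  shows "(\<Sum>c\<in>cliques S I. (- 1) ^ len c * indicator (up S I (u \<odot> c)) \<xi>) = (0 :: real)"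
proof (cases "\<xi> \<in> up S I u")
  case False
  have "up S I (u \<odot> c) \<subseteq> up S I u" if "c \<in> cliques S I" for c
    using that cliques_subset u by (intro up_antimono) auto
  then have "indicator (up S I (u \<odot> c)) \<xi> = (0 :: real)" if "c \<in> cliques S I" for c
    using False that by (auto simp: indicator_def)
  then show ?thesis by simp
next
  case True
  note ideal = infinite_ideal_below_up[OF True]
  obtain v where v: "v \<in> traces" "\<xi> \<in> up S I v" "len v = Suc (len u)"
    using infinite_ideal_ex_len[OF ideal] by blast
  let ?F = "insert u (insert v {u \<odot> c |c. c \<in> cliques S I \<and> \<xi> \<in> up S I (u \<odot> c)})"
  have "finite ?F" using finite_cliques by simp
  moreover have "?F \<subseteq> traces" using u v(1) cliques_subset by auto
  ultimately obtain w where w: "w \<in> traces" "\<xi> \<in> up S I w" "\<forall>t\<in>?F. t \<unlhd> w"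
    using infinite_ideal_finite_upper_bound[OF ideal, of ?F] True v(2) by blast
  then obtain t where t: "t \<in> traces" "w = u \<odot> t" by (auto simp: factor_def)
  have "t \<noteq> \<epsilon>" using le_imp_len_le[of v w] w(3) v u t by auto
  have "\<xi> \<in> up S I (u \<odot> c) \<longleftrightarrow> c \<unlhd> t" if c: "c \<in> cliques S I" for c
  proof -
    have "c \<in> traces" using c cliques_subset by blast
    then have "\<xi> \<in> up S I (u \<odot> c) \<longleftrightarrow> u \<odot> c \<unlhd> w"
      using w c u up_antimono[of "u \<odot> c" w] by blast
    then show ?thesis using t u \<open>c \<in> traces\<close> by simp
  qed
  then have "(\<Sum>c\<in>cliques S I. (- 1) ^ len c * indicator (up S I (u \<odot> c)) \<xi>) =
      (\<Sum>c\<in>cliques S I. if c \<unlhd> t then (- 1) ^ len c else 0 :: real)"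
    by (intro sum.cong) (auto simp: indicator_def)
  also have "\<dots> = (\<Sum>c\<in>{c \<in> cliques S I. c \<unlhd> t}. (- 1) ^ len c)"
    by (simp add: sum.inter_filter finite_cliques)
  also have "\<dots> = 0" using sum_cliques_le[OF t(1)] \<open>t \<noteq> \<epsilon>\<close> by simp
  finally show ?thesis .
qed

section \<open>Probability measures on the boundary\<close>

lemma sets_boundary_space: "sets (boundary_space S I) = sigma_sets (boundary S I) (up S I ` traces)"
  unfolding boundary_space_def using up_subset_boundary by (intro sets_measure_of) auto

lemma measurable_boundary_spaceI:
  assumes "\<And>x. x \<in> space N \<Longrightarrow> \<phi> x \<in> boundary S I"
    and "\<And>u. u \<in> traces \<Longrightarrow> \<phi> -` up S I u \<inter> space N \<in> sets N"
  shows "\<phi> \<in> measurable N (boundary_space S I)"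
  unfolding boundary_space_def using assms up_subset_boundary
  by (intro measurable_measure_of) auto

context
  fixes P assumes P: "boundary_prob S I P"
begin

interpretation prob_space P
  using P by (simp add: boundary_prob_def)

lemma space_boundary_prob: "space P = boundary S I"
  using P sets_eq_imp_space_eq[of P "boundary_space S I"]
  by (simp add: boundary_prob_def boundary_space_def space_measure_of_conv)

lemma up_in_sets: "u \<in> traces \<Longrightarrow> up S I u \<in> sets P"
  using P by (auto simp: boundary_prob_def sets_boundary_space)

lemma measure_up_empty_trace: "measure P (up S I \<epsilon>) = 1"
  using prob_space by (simp add: up_empty_trace space_boundary_prob)

lemma measure_up_recurrence:
  assumes u: "u \<in> traces"
  shows "(\<Sum>c\<in>cliques S I. (- 1) ^ len c * measure P (up S I (u \<odot> c))) = 0"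
proof -
  have sets: "up S I (u \<odot> c) \<in> sets P" if "c \<in> cliques S I" for c
    using that cliques_subset u by (intro up_in_sets) auto
  have "(\<Sum>c\<in>cliques S I. (- 1) ^ len c * measure P (up S I (u \<odot> c))) =
      (\<Sum>c\<in>cliques S I. \<integral>\<xi>. (- 1) ^ len c * indicator (up S I (u \<odot> c)) \<xi> \<partial>P)"
    using sets sets.sets_into_space[OF sets] by (intro sum.cong) (auto simp: Int_absorb2)
  also have "\<dots> = (\<integral>\<xi>. (\<Sum>c\<in>cliques S I. (- 1) ^ len c * indicator (up S I (u \<odot> c)) \<xi>) \<partial>P)"
    using sets
    by (intro Bochner_Integration.integral_sum[symmetric]) (auto simp: emeasure_eq_measure)
  also have "\<dots> = 0" by (simp add: sum_cliques_indicator[OF u])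
  finally show ?thesis .
qed

lemma disjoint_family_up_synchronizing:
  assumes w: "w \<in> traces" "synchronizing w"
  shows "disjoint_family_on (\<lambda>u. up S I (u \<odot> w)) (traces_of_len n)"
  unfolding disjoint_family_on_def
proof (intro ballI impI equals0I)
  fix u v \<xi> assume uv: "u \<in> traces_of_len n" "v \<in> traces_of_len n" "u \<noteq> v"
    and "\<xi> \<in> up S I (u \<odot> w) \<inter> up S I (v \<odot> w)"
  then obtain t where "t \<in> traces" "u \<odot> w \<unlhd> t" "v \<odot> w \<unlhd> t"
    using infinite_ideal_directed[OF infinite_ideal_below_up, of \<xi> "u \<odot> w" "u \<odot> w" "v \<odot> w"] w(1)
    by auto
  then show False using w(2) uv by (auto simp: synchronizing_def)
qed

lemma trace_count_mult_measure_le_1: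
  assumes w: "w \<in> traces" "synchronizing w"
    and q: "\<And>u. u \<in> traces \<Longrightarrow> len u = n + len w \<Longrightarrow> measure P (up S I u) = q"
  shows "trace_count n * q \<le> 1"
proof -
  have "trace_count n * q = (\<Sum>u\<in>traces_of_len n. measure P (up S I (u \<odot> w)))"
    using q w(1) by (simp add: trace_count_def)
  also have "\<dots> = measure P (\<Union>u\<in>traces_of_len n. up S I (u \<odot> w))"
    using disjoint_family_up_synchronizing[OF w] up_in_sets w(1)
    by (intro finite_measure_finite_Union[symmetric] finite_traces_of_len) auto
  also have "\<dots> \<le> 1" by (rule prob_le_1)
  finally show ?thesis .
qed

end

lemma boundary_prob_eqI:
  assumes P: "boundary_prob S I P" and Q: "boundary_prob S I Q"
    and eq: "\<And>u. u \<in> traces \<Longrightarrow> measure P (up S I u) = measure Q (up S I u)"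
  shows "P = Q"
proof -
  interpret P: prob_space P using P by (simp add: boundary_prob_def)
  interpret Q: prob_space Q using Q by (simp add: boundary_prob_def)
  let ?E = "insert {} (up S I ` traces)"
  have sigma: "sigma_sets (boundary S I) (up S I ` traces) = sigma_sets (boundary S I) ?E"
    by (intro sigma_sets_eqI) (auto intro: sigma_sets.Basic sigma_sets.Empty)
  show ?thesis
  proof (rule measure_eqI_generator_eq
      [where E = ?E and \<Omega> = "boundary S I" and A = "\<lambda>_. boundary S I"])
    show "Int_stable ?E" using up_Int by (auto simp: Int_stable_def)
    show "emeasure P X = emeasure Q X" if "X \<in> ?E" for X
      using that eq by (auto simp: P.emeasure_eq_measure Q.emeasure_eq_measure)
    show "sets P = sigma_sets (boundary S I) ?E" "sets Q = sigma_sets (boundary S I) ?E"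
      using P Q by (auto simp: boundary_prob_def sets_boundary_space sigma)
    show "range (\<lambda>_. boundary S I) \<subseteq> ?E" using up_empty_trace by auto
  qed (use up_subset_boundary in auto)
qed

section \<open>Uniform measures\<close>

lemma uniform_bernoulli_imp_uniform:
  assumes "uniform_bernoulli_measure S I P"
  shows "uniform_boundary_measure S I P"
proof -
  have P: "boundary_prob S I P"
    and mult: "\<And>u v. u \<in> traces \<Longrightarrow> v \<in> traces \<Longrightarrow>
      measure P (up S I (u \<odot> v)) = measure P (up S I u) * measure P (up S I v)"
    and letters: "\<And>a b. a \<in> S \<Longrightarrow> b \<in> S \<Longrightarrow>
      measure P (up S I (cls [a])) = measure P (up S I (cls [b]))"
    using assms unfolding uniform_bernoulli_measure_def bernoulli_measure_def by blast+
  obtain b where b: "b \<in> S" using S_nonempty by blast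
  define q where "q = measure P (up S I (cls [b]))"
  have "measure P (up S I (cls w)) = q ^ length w" if "w \<in> lists S" for w
    using that
  proof (induction w)
    case Nil
    show ?case using measure_up_empty_trace[OF P] by (simp add: empty_trace_eq)
  next
    case (Cons a w)
    then show ?case using mult[of "cls [a]" "cls w"] letters[OF Cons.hyps(1) b] by (simp add: q_def)
  qed
  then have "measure P (up S I u) = q ^ len u" if "u \<in> traces" for u
    using that by (elim tracesE) simp
  then show ?thesis using P by (simp add: uniform_boundary_measure_def)
qed

lemma uniform_bernoulli_if_measure_up_eq_power:
  assumes "boundary_prob S I P" "0 < r" "\<And>u. u \<in> traces \<Longrightarrow> measure P (up S I u) = r ^ len u"
  shows "uniform_bernoulli_measure S I P"
  using assms by (simp add: uniform_bernoulli_measure_def bernoulli_measure_def power_add)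

lemma uniform_measure_function_of_len:
  assumes "uniform_boundary_measure S I P"
  obtains f where "\<And>u. u \<in> traces \<Longrightarrow> measure P (up S I u) = f (len u)"
proof -
  obtain g where g: "\<And>n. g n \<in> traces" "\<And>n. len (g n) = n" using ex_trace_of_len by metis
  have "measure P (up S I u) = measure P (up S I (g (len u)))" if "u \<in> traces" for u
    using assms that g(1)[of "len u"] g(2)[of "len u", symmetric]
    unfolding uniform_boundary_measure_def by blast
  then show thesis by (rule that)
qed

context
  fixes P f
  assumes P: "boundary_prob S I P"
    and f: "\<And>u. u \<in> traces \<Longrightarrow> measure P (up S I u) = f (len u)"
begin

lemma uniform_measure_recurrence: "(\<Sum>c\<in>cliques S I. (- 1) ^ len c * f (n + len c)) = 0"
proof -
  obtain u where u: "u \<in> traces" "len u = n" using ex_trace_of_len by blast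
  have "f (n + len c) = measure P (up S I (u \<odot> c))" if "c \<in> cliques S I" for c
    using f[of "u \<odot> c"] u that cliques_subset by auto
  then show ?thesis using measure_up_recurrence[OF P u(1)] by simp
qed

lemma uniform_measure_bigo:
  assumes "irreducible_pair S I"
  shows "f \<in> O(\<lambda>n. growth_radius ^ n)"
proof -
  obtain w where w: "w \<in> traces" "synchronizing w"
    using ex_synchronizing_trace[OF assms] by blast
  have f_le: "f (n + len w) \<le> growth_radius ^ n" for n
  proof -
    have "trace_count n * f (n + len w) \<le> 1"
      using f by (intro trace_count_mult_measure_le_1[OF P w]) simp
    also have "\<dots> \<le> trace_count n * growth_radius ^ n"
      by (rule one_le_trace_count_mult_growth_radius)
    finally show ?thesis using one_le_trace_count[of n] by simp
  qed
  have f_nonneg: "0 \<le> f n" for n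
    using f ex_trace_of_len[of n] measure_nonneg[of P] by metis
  have "norm (f n) \<le> 1 / growth_radius ^ len w * norm (growth_radius ^ n)" if n: "len w \<le> n" for n
  proof -
    have "f n \<le> growth_radius ^ (n - len w)" using f_le[of "n - len w"] n by simp
    also have "\<dots> = 1 / growth_radius ^ len w * growth_radius ^ n"
      using growth_radius_pos n by (simp add: power_diff)
    finally show ?thesis using f_nonneg growth_radius_pos by simp
  qed
  then show ?thesis by (intro bigoI eventually_sequentiallyI)
qed

end

lemma measure_up_eq_power_if_uniform:
  assumes irreducible: "irreducible_pair S I"
    and root: "unique_smallest_root (moebius_poly S I) p0"
    and P: "uniform_boundary_measure S I P" and "u \<in> traces"
  shows "measure P (up S I u) = growth_radius ^ len u"
proof -
  have prob: "boundary_prob S I P" using P by (simp add: uniform_boundary_measure_def)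
  obtain f where f: "\<And>u. u \<in> traces \<Longrightarrow> measure P (up S I u) = f (len u)"
    using P by (rule uniform_measure_function_of_len) blast
  have p0: "p0 = of_real growth_radius" by (rule unique_smallest_root_eq_growth_radius[OF root])
  have "shift_op [:- p0, 1:] (\<lambda>n. complex_of_real (f n)) n = 0" for n
  proof (rule recurrence_solution_geometric)
    show "p0 \<noteq> 0" using growth_radius_pos p0 by simp
    show "moebius_poly S I \<noteq> 0" using growth_mult_moebius[of 0] growth_radius_pos by auto
    show "w = p0 \<or> cmod p0 < cmod w" if "poly (moebius_poly S I) w = 0" for w
      using root that by (auto simp: unique_smallest_root_def)
    show "shift_op (moebius_poly S I) (\<lambda>n. complex_of_real (f n)) n = 0" for n
    proof -
      have "shift_op (moebius_poly S I) (\<lambda>n. complex_of_real (f n)) n =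
          of_real (\<Sum>c\<in>cliques S I. (- 1) ^ len c * f (n + len c))"
        by (simp add: moebius_poly_def shift_op_sum shift_op_monom)
      then show ?thesis using uniform_measure_recurrence[OF prob f] by simp
    qed
    have "(\<lambda>n. complex_of_real (f n)) \<in> O(\<lambda>n. complex_of_real (growth_radius ^ n))"
      using uniform_measure_bigo[OF prob f irreducible] by (simp only: landau_o.big.of_real_iff)
    then show "(\<lambda>n. complex_of_real (f n)) \<in> O(\<lambda>n. p0 ^ n)" by (simp add: p0)
  qed
  then have "complex_of_real (f (Suc n)) = of_real (growth_radius * f n)" for n
    by (simp add: shift_op_pCons p0)
  then have "f (Suc n) = growth_radius * f n" for n by (simp only: of_real_eq_iff)
  then have "f n = growth_radius ^ n * f 0" for n by (induction n) simp_all
  moreover have "f 0 = 1" using measure_up_empty_trace[OF prob] f[of \<epsilon>] by simp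
  ultimately show ?thesis using f[OF \<open>u \<in> traces\<close>] by simp
qed

section \<open>Existence of the uniform measure\<close>

context
  fixes \<nu> :: "'a list set set \<Rightarrow> real" and N :: "('a list set \<Rightarrow> bool) measure"
  assumes \<nu>: "prob_charge \<nu>" "\<nu> traces = 1" "\<And>u. u \<in> traces \<Longrightarrow> \<nu> {u} = 0"
    and N: "prob_space N" "\<And>A. clopen A \<Longrightarrow> A \<in> sets N"
    and measure_N: "\<And>A. clopen A \<Longrightarrow> measure N A = \<nu> {v. (\<lambda>u. u \<unlhd> v) \<in> A}"
begin

lemma AE_clopen_if_all_but_one:
  assumes Q: "clopen {x. Q x}" and u: "u \<in> traces"
    and all_but_one: "\<And>v. v \<in> traces \<Longrightarrow> v \<noteq> u \<Longrightarrow> Q (\<lambda>t. t \<unlhd> v)"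
  shows "AE x in N. Q x"
proof -
  let ?A = "{v. Q (\<lambda>t. t \<unlhd> v)}"
  have "\<nu> (- ?A) \<le> \<nu> ({u} \<union> - insert u traces)"
    using all_but_one by (intro prob_charge_mono[OF \<nu>(1)]) auto
  also have "\<dots> = \<nu> {u} + \<nu> (- traces)"
    using u prob_charge_Un[OF \<nu>(1), of "{u}" "- traces"] by (simp add: insert_absorb)
  also have "\<dots> = 0" using \<nu> u by (simp add: prob_charge_Compl)
  finally have "1 \<le> \<nu> ?A" using prob_charge_Compl[OF \<nu>(1), of ?A] by simp
  then have "measure N {x. Q x} = 1"
    using measure_N[OF Q] prob_charge_le_1[OF \<nu>(1), of ?A] by simp
  then show ?thesis using prob_space.AE_in_set_eq_1[OF N(1) N(2)[OF Q]] by simp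
qed

lemma AE_downward:
  assumes "u \<in> traces"
  shows "AE x in N. u \<unlhd> v \<and> x v \<longrightarrow> x u"
proof (cases "u \<unlhd> v")
  case True
  have "AE x in N. x v \<longrightarrow> x u"
  proof (rule AE_clopen_if_all_but_one[OF _ one_closed]; (intro clopen_Collect_intros impI)?)
    show "u \<unlhd> t" if "v \<unlhd> t" for t using divides_trans[OF True that assms] .
  qed
  then show ?thesis by (rule eventually_mono) simp
qed simp

lemma AE_lcm:
  assumes "u \<in> traces" "v \<in> traces"
  shows "AE x in N. x u \<and> x v \<longrightarrow> (\<exists>w\<in>traces. w lcmof\<^bsub>M\<^esub> u v \<and> x w)"
proof -
  have "AE x in N. x u \<and> x v \<longrightarrow> (\<exists>w\<in>{w \<in> traces. w lcmof\<^bsub>M\<^esub> u v}. x w)"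
  proof (rule AE_clopen_if_all_but_one[OF _ one_closed];
      (intro clopen_Collect_intros finite_lcms impI)?)
    fix t assume t: "t \<in> traces" "u \<unlhd> t \<and> v \<unlhd> t"
    then obtain w where "w \<in> traces" "w lcmof\<^bsub>M\<^esub> u v" using ex_lcm[OF assms] by blast
    then show "\<exists>w\<in>{w \<in> traces. w lcmof\<^bsub>M\<^esub> u v}. w \<unlhd> t" using t by (auto simp: islcm_def)
  qed
  then show ?thesis by (auto elim: eventually_mono)
qed

lemma AE_mult_letter:
  assumes "u \<in> traces"
  shows "AE x in N. x u \<longrightarrow> (\<exists>a\<in>S. x (u \<odot> cls [a]))"
proof (rule AE_clopen_if_all_but_one[OF _ assms]; (intro clopen_Collect_intros finite_S impI)?)
  show "\<exists>a\<in>S. u \<odot> cls [a] \<unlhd> v" if "v \<in> traces" "v \<noteq> u" "u \<unlhd> v" for v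
    using ex_mult_letter_le assms that by blast
qed

lemma AE_infinite_ideal: "AE x in N. infinite_ideal x"
proof -
  have "AE x in N. x \<epsilon>"
    by (rule AE_clopen_if_all_but_one[OF clopen_Collect_coordinate one_closed]) simp
  moreover have "AE x in N. \<forall>u\<in>traces. \<forall>v\<in>traces. u \<unlhd> v \<and> x v \<longrightarrow> x u"
    unfolding AE_ball_countable[OF countable_traces] using AE_downward by blast
  moreover have "AE x in N. \<forall>u\<in>traces. \<forall>v\<in>traces. x u \<and> x v \<longrightarrow>
      (\<exists>w\<in>traces. w lcmof\<^bsub>M\<^esub> u v \<and> x w)"
    unfolding AE_ball_countable[OF countable_traces] using AE_lcm by blast
  moreover have "AE x in N. \<forall>u\<in>traces. x u \<longrightarrow> (\<exists>a\<in>S. x (u \<odot> cls [a]))"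
    unfolding AE_ball_countable[OF countable_traces] using AE_mult_letter by blast
  ultimately show ?thesis unfolding infinite_ideal_def by eventually_elim blast
qed

end

lemma ex_boundary_prob_of_ideal_measure:
  fixes N :: "('a list set \<Rightarrow> bool) measure"
  assumes "prob_space N" "space N = UNIV" and coordinate: "\<And>u. u \<in> traces \<Longrightarrow> {x. x u} \<in> sets N"
    and ideal: "AE x in N. infinite_ideal x"
  shows "\<exists>P. boundary_prob S I P \<and> (\<forall>u\<in>traces. measure P (up S I u) = measure N {x. x u})"
proof -
  interpret N: prob_space N by fact
  obtain E where E: "E \<subseteq> {x. infinite_ideal x}" "E \<in> sets N" "measure N E = 1"
    using N.AE_E_prob[OF ideal] assms(2) by auto
  then have "\<forall>x\<in>E. \<exists>\<xi>. \<xi> \<in> boundary S I \<and> (\<forall>u\<in>traces. \<xi> \<in> up S I u \<longleftrightarrow> x u)"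
    using ex_boundary_of_infinite_ideal by blast
  then obtain \<phi> where \<phi>: "\<And>x. x \<in> E \<Longrightarrow> \<phi> x \<in> boundary S I"
    "\<And>x u. x \<in> E \<Longrightarrow> u \<in> traces \<Longrightarrow> \<phi> x \<in> up S I u \<longleftrightarrow> x u" by metis
  define N' where "N' = restrict_space N E"
  have space_N': "space N' = E" using assms(2) by (simp add: N'_def space_restrict_space)
  interpret N': prob_space N'
    unfolding N'_def using E(2,3)
    by (intro prob_space_restrict_space) (simp_all add: N.emeasure_eq_measure)
  have vimage: "\<phi> -` up S I u \<inter> space N' = {x. x u} \<inter> E" if "u \<in> traces" for u
    using \<phi>(2) that by (auto simp: space_N')
  have "{x. x u} \<inter> E \<in> sets N'" if "u \<in> traces" for u
    using that E(2) coordinate by (simp add: N'_def sets_restrict_space_iff sets.Int)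
  then have measurable: "\<phi> \<in> measurable N' (boundary_space S I)"
    using \<phi>(1) by (intro measurable_boundary_spaceI) (simp_all add: vimage, simp add: space_N')
  let ?P = "distr N' (boundary_space S I) \<phi>"
  have "measure ?P (up S I u) = measure N {x. x u}" if u: "u \<in> traces" for u
  proof -
    have "measure ?P (up S I u) = measure N' ({x. x u} \<inter> E)"
      using measurable u by (simp add: measure_distr vimage sets_boundary_space sigma_sets.Basic)
    also have "\<dots> = measure N ({x. x u} \<inter> E)"
      using E(2) by (simp add: N'_def measure_restrict_space)
    also have "\<dots> = measure N {x. x u}"
    proof (rule N.finite_measure_eq_AE)
      have "AE x in N. x \<in> E" using N.AE_in_set_eq_1[OF E(2)] E(3) by simp
      then show "AE x in N. x \<in> {x. x u} \<inter> E \<longleftrightarrow> x \<in> {x. x u}" by eventually_elim simp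
    qed (use coordinate[OF u] E(2) in auto)
    finally show ?thesis .
  qed
  moreover have "boundary_prob S I ?P"
    using N'.prob_space_distr[OF measurable] by (simp add: boundary_prob_def)
  ultimately show ?thesis by blast
qed

lemma ex_boundary_prob_growth_radius:
  "\<exists>P. boundary_prob S I P \<and> (\<forall>u\<in>traces. measure P (up S I u) = growth_radius ^ len u)"
proof -
  obtain \<nu> where \<nu>: "prob_charge \<nu>" "\<nu> traces = 1"
    "\<And>u. u \<in> traces \<Longrightarrow> \<nu> {v. u \<unlhd> v} = growth_radius ^ len u" "\<And>u. u \<in> traces \<Longrightarrow> \<nu> {u} = 0"
    by (rule ex_limit_of_boltzmann) blast
  have "compact (UNIV :: ('a list set \<Rightarrow> bool) set)"
    by (intro compact_UNIV_fun finite_imp_compact) simp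
  then obtain N where N: "prob_space N" "space N = UNIV" "\<And>A. clopen A \<Longrightarrow> A \<in> sets N"
    "\<And>A. clopen A \<Longrightarrow> measure N A = \<nu> ((\<lambda>v u. u \<unlhd> v) -` A)"
    using ex_prob_space_eq_charge_on_clopen prob_charge_vimage[OF \<nu>(1)] by blast
  have "AE x in N. infinite_ideal x"
    by (rule AE_infinite_ideal[OF \<nu>(1,2,4) N(1,3)]) (simp_all add: N(4) vimage_def)
  then obtain P where "boundary_prob S I P" "\<forall>u\<in>traces. measure P (up S I u) = measure N {x. x u}"
    using ex_boundary_prob_of_ideal_measure[OF N(1,2) N(3)[OF clopen_Collect_coordinate]] by blast
  moreover have "measure N {x. x u} = growth_radius ^ len u" if "u \<in> traces" for u
    using N(4)[OF clopen_Collect_coordinate] \<nu>(3)[OF that] by (simp add: vimage_def)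
  ultimately show ?thesis by auto
qed

end

theorem theorem2p6:
  fixes S :: "'a set" and I :: "('a \<times> 'a) set" and p0 :: complex
  assumes "independence_pair S I"
    and "irreducible_pair S I"
    and "unique_smallest_root (moebius_poly S I) p0"
  shows "\<exists>P0.
    uniform_bernoulli_measure S I P0 \<and>
    (\<forall>P. uniform_bernoulli_measure S I P \<longrightarrow> P = P0) \<and>
    (\<forall>u\<in>carrier (trace_monoid S I).
       complex_of_real (measure P0 (up S I u)) = p0 ^ trace_length u) \<and>
    (\<forall>P. boundary_prob S I P \<and>
       (\<forall>u\<in>carrier (trace_monoid S I).
          complex_of_real (measure P (up S I u)) = p0 ^ trace_length u) \<longrightarrow> P = P0) \<and>
    (\<forall>P. uniform_boundary_measure S I P \<longrightarrow> uniform_bernoulli_measure S I P) \<and>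
    uniform_boundary_measure S I P0 \<and>
    (\<forall>P. uniform_boundary_measure S I P \<longrightarrow> P = P0)"
proof -
  interpret trace_pair S I by (rule trace_pair.intro[OF assms(1)])
  obtain P0 where P0: "boundary_prob S I P0"
    and power: "\<And>u. u \<in> traces \<Longrightarrow> measure P0 (up S I u) = growth_radius ^ len u"
    using ex_boundary_prob_growth_radius by blast
  have bernoulli: "uniform_bernoulli_measure S I P0"
    by (rule uniform_bernoulli_if_measure_up_eq_power[OF P0 growth_radius_pos power])
  have power_unique: "P = P0" if "boundary_prob S I P"
    "\<And>u. u \<in> traces \<Longrightarrow> measure P (up S I u) = growth_radius ^ len u" for P
    by (rule boundary_prob_eqI[OF that(1) P0]) (simp add: that(2) power)
  have uniform_unique: "P = P0" if "uniform_boundary_measure S I P" for P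
    using that measure_up_eq_power_if_uniform[OF assms(2,3) that]
    by (intro power_unique) (auto simp: uniform_boundary_measure_def)
  have "complex_of_real x = p0 ^ n \<longleftrightarrow> x = growth_radius ^ n" for x n
    unfolding unique_smallest_root_eq_growth_radius[OF assms(3)]
    by (metis of_real_eq_iff of_real_power)
  then show ?thesis
    using bernoulli power power_unique uniform_unique uniform_bernoulli_imp_uniform
    by (intro exI[of _ P0]) blast
qed

end
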